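(* Let $n\ge1$ and let $X$ be a connected and locally connected complete metric space having the property $H(n-1,\mathbb Z)$, and let $M$ be an $F_\sigma$-subset of $X$ with $\dim M\le n-2$. Then $U\setminus M$ is arcwise connected for every open connected set $U\subset X$ with $U\setminus M\ne\varnothing$.
   Context: Homology is singular homology, reduced in dimension $0$. $X$ has the property $H(m,\mathbb Z)$ if $H_k(X,X\setminus\{x\};\mathbb Z)=0$ for all $k\le m$ and all $x\in X$. $\dim$ is covering dimension. *)

theory Defs
  imports "HOL-Analysis.Analysis" "HOL-Homology.Homology"
begin

definition covering_dim_le :: "'a topology \<Rightarrow> int \<Rightarrow> bool" where
  "covering_dim_le X n \<longleftrightarrow> n \<ge> -1 \<and>
     (\<forall>\<U>. finite \<U> \<and> (\<forall>U\<in>\<U>. openin X U) \<and> \<Union>\<U> = topspace X \<longrightarrow>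
        (\<exists>\<V>. finite \<V> \<and> (\<forall>V\<in>\<V>. openin X V) \<and> \<Union>\<V> = topspace X \<and>
             (\<forall>V\<in>\<V>. \<exists>U\<in>\<U>. V \<subseteq> U) \<and>
             (\<forall>x\<in>topspace X. int (card {V\<in>\<V>. x \<in> V}) \<le> n + 1)))"

text \<open>Property H(m,Z): H_k(X, X - {x}; Z) = 0 for all k \<le> m and x \<in> X, with singular
homology reduced in dimension 0 (so for X - {x} = {} the reduced group of X is used).\<close>
definition has_local_H :: "int \<Rightarrow> 'a topology \<Rightarrow> bool" where
  "has_local_H m X \<longleftrightarrow>
     (\<forall>x\<in>topspace X. \<forall>k\<le>m.
        trivial_group (if topspace X - {x} = {} then reduced_homology_group k X
                       else relative_homology_group k X (topspace X - {x})))"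

definition arcwise_connected :: "'a::topological_space set \<Rightarrow> bool" where
  "arcwise_connected S \<longleftrightarrow>
     (\<forall>x\<in>S. \<forall>y\<in>S. x \<noteq> y \<longrightarrow>
        (\<exists>g. arc g \<and> path_image g \<subseteq> S \<and> pathstart g = x \<and> pathfinish g = y))"

end

theory Submission
  imports Defs
begin

text \<open>A closed set \<open>A\<close> of dimension at most \<open>n - 2\<close> satisfies \<open>H_k(U, U - A) = 0\<close> for \<open>k \<le> 1\<close> and every
open \<open>U\<close>: induction on the dimension by Mayer--Vietoris, where a closed set carrying a given class
and minimal with this property would have two points, which a closed set of smaller dimension
separates.  Hence \<open>U - A\<close> is connected and nonempty whenever \<open>U\<close> is open and connected.  Write
\<open>M\<close> as a union of closed sets \<open>F i\<close>.  A path in \<open>U - M\<close> is a limit of chains of small open connected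
sets, each chain being refined inside the previous one so as to avoid the next \<open>F i\<close>.

The separating sets come from a definition of dimension by towers of locally finite closed
covers with mesh tending to zero; Dowker's theorem provides such towers from the definition by
finite open covers.\<close>

section \<open>Relative singular homology\<close>

text \<open>Dimension trades against homological degree. With \<open>cover_tower d\<close> standing
  for dimension at most \<open>d - 1\<close>, vanishing in degree \<open>k\<close> is proved
  whenever \<open>k + d \<le> n\<close>. A separation lowers \<open>d\<close> and raises
  \<open>k\<close> by one, so the bound persists, and a single point is met only in degrees up to
  \<open>n - 1\<close>, the range of the hypothesis. At the start \<open>d = n - 1\<close>, which
  leaves exactly the degrees 0 and 1, the two that decide connectedness of a complement. Two
  obstacles shape the rest. Mayer--Vietoris and compact support need open complements, so homology
  treats one closed \<open>F i\<close> at a time; the complement of all of them together is in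
  general not open, and its paths have to come from completeness. Moreover the space may be
  nonseparable, and the separators must be closed sets of visibly smaller dimension; towers reduce
  this to counting the members through a point.\<close>

lemma trivial_relative_homology_group_iff:
  "trivial_group (relative_homology_group (int p) X S) \<longleftrightarrow>
     (\<forall>c. singular_relcycle p X S c \<longrightarrow> singular_relboundary p X S c)"
proof -
  let ?Z = "singular_relcycle_set p X S" and ?h = "homologous_rel_set p X S"
  have "trivial_group (relative_homology_group (int p) X S) \<longleftrightarrow> ?h ` ?Z = {singular_relboundary_set p X S}"
    unfolding trivial_group_def by (simp add: carrier_relative_homology_group)
  also have "\<dots> \<longleftrightarrow> (\<forall>c\<in>?Z. ?h c = singular_relboundary_set p X S)"
  proof -
    have "0 \<in> ?Z"
      by simp
    then show ?thesis
      by (simp add: set_eq_iff[of "?h ` ?Z"] image_iff) (metis singular_relcycle_0)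
  qed
  finally show ?thesis
    by (simp only: homologous_rel_set_eq_relboundary) simp
qed

lemma kernel_hom_induced_trivial:
  assumes "exact_seq ([G1, G2, G3], [g, f])" "trivial_group G3" "x \<in> carrier G2" "g x = \<one>\<^bsub>G1\<^esub>"
  shows "x = \<one>\<^bsub>G2\<^esub>"
proof -
  have "f ` carrier G3 = kernel G2 G1 g"
    using exact_seq_imp_exact_hom_arbitrary[OF assms(1), of 0] by simp
  then have "x \<in> f ` carrier G3"
    using assms by (auto simp: kernel_def)
  then have "x = f \<one>\<^bsub>G3\<^esub>"
    using assms(2) by (auto simp: trivial_group_def)
  moreover have "group_hom G3 G2 f"
    using exact_seq_imp_group_hom_arbitrary[OF assms(1), of 1] by simp
  ultimately show ?thesis
    by (simp add: group_hom.hom_one)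
qed

lemma singular_relcycle_mono:
  assumes "singular_relcycle p X S c" "S \<subseteq> T"
  shows "singular_relcycle p X T c"
  using assms singular_chain_mono by (auto simp: singular_relcycle)

lemma hom_induced_id_relcycle:
  assumes "singular_relcycle p X S c" "S \<subseteq> T"
  shows "hom_induced (int p) X S X T id (homologous_rel_set p X S c) = homologous_rel_set p X T c"
proof -
  have "chain_map p id c = c"
    using assms chain_map_ident singular_relcycle_def by metis
  then show ?thesis
    using hom_induced_chain_map[of X X id S T p c] assms by (simp add: subset_iff Pi_iff)
qed

text \<open>A piece of the relative Mayer--Vietoris sequence, by a diagram chase. A class of (X, P
  \<inter> Q) that dies in (X, P) comes from (P, P \<inter> Q), which excision identifies with (P
  \<union> Q, Q). There it dies in (X, Q), and the kernel of that map is the image of the group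
  assumed trivial.\<close>

lemma singular_relboundary_Int:
  assumes "openin X P" "openin X Q"
    and triv: "trivial_group (relative_homology_group (int (Suc p)) X (P \<union> Q))"
    and c: "singular_relcycle p X (P \<inter> Q) c"
    and cP: "singular_relboundary p X P c"
    and cQ: "singular_relboundary p X Q c"
  shows "singular_relboundary p X (P \<inter> Q) c"
proof -
  let ?T = "P \<inter> Q"
  let ?H = "relative_homology_group (int p)"
  define z where "z = homologous_rel_set p X ?T c"
  have z: "z \<in> carrier (?H X ?T)"
    using c by (auto simp: z_def carrier_relative_homology_group)
  have zP: "hom_induced (int p) X ?T X P id z = \<one>\<^bsub>?H X P\<^esub>"
    using cP by (simp add: z_def hom_induced_id_relcycle[OF c] homologous_rel_set_eq_relboundary)
  have zQ: "hom_induced (int p) X ?T X Q id z = \<one>\<^bsub>?H X Q\<^esub>"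
    using cQ by (simp add: z_def hom_induced_id_relcycle[OF c] homologous_rel_set_eq_relboundary)
  have "z \<in> kernel (?H X ?T) (?H X P) (hom_induced (int p) X ?T X P id)"
    using z zP by (simp add: kernel_def)
  then have "z \<in> hom_induced (int p) (subtopology X P) ?T X ?T id ` carrier (?H (subtopology X P) ?T)"
    using exact_seq_imp_exact_hom_arbitrary[OF homology_exactness_triple_3[of ?T P "int p" X], of 0] by simp
  then obtain a where a: "a \<in> carrier (?H (subtopology X P) ?T)"
    and za: "z = hom_induced (int p) (subtopology X P) ?T X ?T id a"
    by blast
  \<comment> \<open>The class \<open>a\<close> seen in (P \<union> Q, Q). The two routes from (P, P
    \<inter> Q) to (X, Q) agree, so \<open>b\<close> dies in (X, Q) because \<open>z\<close>
    does.\<close>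
  define b where "b = hom_induced (int p) (subtopology X P) ?T (subtopology X (P \<union> Q)) Q id a"
  have contP: "continuous_map (subtopology X P) (subtopology X (P \<union> Q)) id"
    by (rule continuous_map_into_subtopology) (auto simp: continuous_map_from_subtopology)
  have "hom_induced (int p) (subtopology X (P \<union> Q)) Q X Q id b
       = hom_induced (int p) (subtopology X P) ?T X Q id a"
    unfolding b_def
    by (subst hom_induced_compose'[OF contP]) (auto simp: continuous_map_from_subtopology)
  also have "\<dots> = hom_induced (int p) X ?T X Q id z"
    unfolding za
    by (subst hom_induced_compose') (auto simp: continuous_map_from_subtopology)
  finally have b1: "hom_induced (int p) (subtopology X (P \<union> Q)) Q X Q id b = \<one>\<^bsub>?H X Q\<^esub>"
    using zQ by simp
  have bc: "b \<in> carrier (?H (subtopology X (P \<union> Q)) Q)"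
    by (simp add: b_def hom_induced_carrier)
  have b0: "b = \<one>\<^bsub>?H (subtopology X (P \<union> Q)) Q\<^esub>"
  proof -
    have "exact_seq ([?H X Q, ?H (subtopology X (P \<union> Q)) Q, relative_homology_group (int (Suc p)) X (P \<union> Q)],
         [hom_induced (int p) (subtopology X (P \<union> Q)) Q X Q id, hom_relboundary (int (Suc p)) X (P \<union> Q) Q])"
      using homology_exactness_triple_2[of Q "P \<union> Q" "int (Suc p)" X] by simp
    from kernel_hom_induced_trivial[OF this triv bc b1] show ?thesis .
  qed
  let ?Y = "subtopology X (P \<union> Q)"
  \<comment> \<open>Excision of \<open>Q - P\<close>, which is closed in \<open>P \<union> Q\<close>
    since \<open>P\<close> is open, and lies in the open set \<open>Q\<close>.\<close>
  have iso: "hom_induced (int p) (subtopology ?Y ((P \<union> Q) - (Q - P))) (Q - (Q - P)) (subtopology ?Y (P \<union> Q)) Q id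
    \<in> iso (?H (subtopology ?Y ((P \<union> Q) - (Q - P))) (Q - (Q - P)))
          (?H (subtopology ?Y (P \<union> Q)) Q)"
  proof (rule homology_excision_axiom)
    have PX: "P \<subseteq> topspace X" "Q \<subseteq> topspace X"
      using assms openin_subset by blast+
    have "openin ?Y P"
      using assms by (simp add: openin_open_subtopology openin_Un)
    then have "closedin ?Y (topspace ?Y - P)"
      by blast
    moreover have "topspace ?Y - P = Q - P"
      using PX by auto
    ultimately have "?Y closure_of (Q - P) = Q - P"
      by (simp add: closure_of_closedin)
    moreover have "?Y interior_of Q = Q"
      using assms by (simp add: interior_of_openin openin_open_subtopology openin_Un)
    ultimately show "?Y closure_of (Q - P) \<subseteq> ?Y interior_of Q"
      by auto
  qed auto
  have eqs: "(P \<union> Q) - (Q - P) = P" "Q - (Q - P) = ?T" "subtopology ?Y P = subtopology X P"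
       "subtopology ?Y (P \<union> Q) = ?Y"
    by (auto simp: subtopology_subtopology Int_absorb1 Int_absorb2)
  have iso': "hom_induced (int p) (subtopology X P) ?T ?Y Q id \<in> iso (?H (subtopology X P) ?T) (?H ?Y Q)"
    using iso unfolding eqs .
  have "inj_on (hom_induced (int p) (subtopology X P) ?T ?Y Q id) (carrier (?H (subtopology X P) ?T))"
    using iso' by (simp add: iso_def bij_betw_def)
  moreover have "hom_induced (int p) (subtopology X P) ?T ?Y Q id (\<one>\<^bsub>?H (subtopology X P) ?T\<^esub>) = \<one>\<^bsub>?H ?Y Q\<^esub>"
    by (rule hom_one[OF hom_induced_hom]) auto
  ultimately have "a = \<one>\<^bsub>?H (subtopology X P) ?T\<^esub>"
    using a b0 unfolding b_def inj_on_def
    using group.is_monoid[OF group_relative_homology_group] monoid.one_closed by metis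
  then have "z = \<one>\<^bsub>?H X ?T\<^esub>"
    unfolding za by (simp only:) (rule hom_one[OF hom_induced_hom], auto)
  then show ?thesis
    by (simp add: z_def homologous_rel_set_eq_relboundary)
qed

text \<open>Compact support: a relative boundary is a boundary in \<open>X\<close> plus a chain
  \<open>e\<close> in the subspace, and only \<open>e\<close> restricts the subspace. The images of
  its finitely many simplices form a compact set, which by directedness lies in a single
  member.\<close>

lemma singular_relboundary_directed_Union:
  assumes "\<P> \<noteq> {}" and "\<And>P. P \<in> \<P> \<Longrightarrow> openin X P"
    and dir: "\<And>P Q. P \<in> \<P> \<Longrightarrow> Q \<in> \<P> \<Longrightarrow> P \<subseteq> Q \<or> Q \<subseteq> P"
    and c: "singular_relboundary p X (\<Union>\<P>) c"
  shows "\<exists>P\<in>\<P>. singular_relboundary p X P c"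
proof -
  obtain d e where d: "singular_chain (Suc p) X d" and e: "singular_chain p (subtopology X (\<Union>\<P>)) e"
    and c: "chain_boundary (Suc p) d + e = c"
    using c by (auto simp: singular_relboundary)
  define K where "K = (\<Union>f\<in>Poly_Mapping.keys e. f ` standard_simplex p)"
  have ek: "singular_simplex p (subtopology X (\<Union>\<P>)) f" if "f \<in> Poly_Mapping.keys e" for f
    using e that by (auto simp: singular_chain_def)
  have "compactin X K"
    unfolding K_def
  proof (rule compactin_Union)
    fix S assume "S \<in> (\<lambda>f. f ` standard_simplex p) ` Poly_Mapping.keys e"
    then obtain f where f: "f \<in> Poly_Mapping.keys e" "S = f ` standard_simplex p" by blast
    have "continuous_map (subtopology (powertop_real UNIV) (standard_simplex p)) X f"
      using ek[OF f(1)] unfolding singular_simplex_def by (blast intro: continuous_map_into_fulltopology)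
    moreover have "compactin (subtopology (powertop_real UNIV) (standard_simplex p)) (standard_simplex p)"
      by (simp add: compactin_subtopology compactin_standard_simplex)
    ultimately show "compactin X S"
      unfolding f(2) using image_compactin by blast
  qed auto
  moreover have "K \<subseteq> \<Union>\<P>"
    using e by (auto simp: K_def singular_chain_subtopology)
  ultimately obtain \<F> where \<F>: "finite \<F>" "\<F> \<subseteq> \<P>" "K \<subseteq> \<Union>\<F>"
    using assms(2) unfolding compactin_def by meson
  have "\<exists>P\<in>\<P>. \<Union>\<F> \<subseteq> P"
    using \<F>(1,2)
  proof (induction rule: finite_induct)
    case empty
    then show ?case using \<open>\<P> \<noteq> {}\<close> by auto
  next
    case (insert Q \<F>)
    then obtain P where "P \<in> \<P>" "\<Union>\<F> \<subseteq> P" by auto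
    then show ?case
      using dir[of P Q] insert.prems by auto
  qed
  then obtain P where P: "P \<in> \<P>" "K \<subseteq> P"
    using \<F> by auto
  then have "singular_chain p (subtopology X P) e"
    using e by (auto simp: singular_chain_subtopology K_def)
  then have "singular_relboundary p X P c"
    using c d by (auto simp: singular_relboundary)
  with P show ?thesis by blast
qed

text \<open>Excision of the complement of \<open>U\<close>, a closed set inside the open complement
  of \<open>A\<close>. It carries the hypothesis at a point over to every open
  neighbourhood.\<close>

lemma trivial_relative_homology_group_open_subset:
  assumes "openin X U" "closedin X A" "A \<subseteq> U"
    and triv: "trivial_group (relative_homology_group p X (topspace X - A))"
  shows "trivial_group (relative_homology_group p (subtopology X U) (U - A))"
proof -
  let ?E = "topspace X - U"
  have U: "U \<subseteq> topspace X"
    using assms openin_subset by blast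
  have iso: "hom_induced p (subtopology X (topspace X - ?E)) ((topspace X - A) - ?E) (subtopology X (topspace X)) (topspace X - A) id
    \<in> iso (relative_homology_group p (subtopology X (topspace X - ?E)) ((topspace X - A) - ?E))
          (relative_homology_group p (subtopology X (topspace X)) (topspace X - A))"
  proof (rule homology_excision_axiom)
    show "X closure_of ?E \<subseteq> X interior_of (topspace X - A)"
      using assms by (auto simp: closure_of_closedin interior_of_openin openin_diff closedin_diff)
  qed auto
  have eqs: "topspace X - ?E = U" "(topspace X - A) - ?E = U - A" "subtopology X (topspace X) = X"
    using U by auto
  have "relative_homology_group p (subtopology X U) (U - A) \<cong> relative_homology_group p X (topspace X - A)"
    using iso unfolding eqs by (rule is_isoI)
  then show ?thesis
    using triv isomorphic_group_triviality[OF _ group_relative_homology_group group_relative_homology_group] by blast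
qed

text \<open>In the exact sequence of the pair both neighbours vanish, so \<open>S\<close> and
  \<open>X\<close> have isomorphic unreduced groups in degree 0. These determine the number of path
  components, which is one for \<open>X\<close>.\<close>

lemma path_connected_subspace_if_trivial_relative_homology:
  assumes X: "path_connected_space X" "topspace X \<noteq> {}" and S: "S \<subseteq> topspace X"
    and 0: "trivial_group (relative_homology_group 0 X S)"
    and 1: "trivial_group (relative_homology_group 1 X S)"
  shows "path_connectedin X S" "S \<noteq> {}"
proof -
  have "hom_induced 0 (subtopology X S) {} X {} id
         \<in> iso (homology_group 0 (subtopology X S)) (homology_group 0 X)"
  proof (rule very_short_exact_sequence)
    show "exact_seq
         ([relative_homology_group 0 X S, homology_group 0 X,
           homology_group 0 (subtopology X S), relative_homology_group 1 X S],
          [hom_induced 0 X {} X S id, hom_induced 0 (subtopology X S) {} X {} id, hom_relboundary 1 X S {}])"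
      using homology_exactness_triple_2 [of "{}" S 1 X] homology_exactness_triple_3 [of "{}" S 0 X]
      by simp
  qed (use 0 1 in auto)
  then have iso: "homology_group 0 (subtopology X S) \<cong> homology_group 0 X"
    by (rule is_isoI)
  then show "path_connectedin X S"
    using X S isomorphic_homology_imp_path_connectedness by (auto simp: path_connectedin_def)
  have "path_components_of (subtopology X S) \<approx> path_components_of X"
    using isomorphic_homology_imp_path_components[OF iso] .
  moreover have "path_components_of X \<noteq> {}"
    using X by (simp add: path_components_of_eq_empty)
  ultimately have "path_components_of (subtopology X S) \<noteq> {}"
    by (metis eqpoll_empty_iff_empty eqpoll_sym)
  then show "S \<noteq> {}"
    by (auto simp: path_components_of_eq_empty)
qed

section \<open>Towers of closed covers\<close>

text \<open>The index \<open>d\<close> bounds the order, so it is the dimension bound plus one.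
  Refinement lets a division of one cover into two classes descend to all later covers. Local
  finiteness keeps unions of members closed and gives \<open>card\<close> its meaning, an infinite
  set having \<open>card\<close> 0.\<close>

definition cover_tower :: "nat \<Rightarrow> 'a::metric_space set \<Rightarrow> bool" where
  "cover_tower d B \<longleftrightarrow> (\<exists>F :: nat \<Rightarrow> 'a set set. \<forall>i.
     locally_finite_in euclidean (F i) \<and> (\<forall>C\<in>F i. closed C) \<and> \<Union>(F i) = B \<and>
     (\<forall>C\<in>F (Suc i). \<exists>C'\<in>F i. C \<subseteq> C') \<and>
     (\<forall>C\<in>F i. \<forall>x\<in>C. \<forall>y\<in>C. dist x y < inverse (Suc i)) \<and>
     (\<forall>x. card {C \<in> F i. x \<in> C} \<le> d))"

lemma cover_towerE:
  fixes B :: "'a::metric_space set"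
  assumes "cover_tower d B"
  obtains F :: "nat \<Rightarrow> 'a set set" where "\<And>i. locally_finite_in euclidean (F i)"
    "\<And>i C. C \<in> F i \<Longrightarrow> closed C" "\<And>i. \<Union>(F i) = B"
    "\<And>i C. C \<in> F (Suc i) \<Longrightarrow> \<exists>C'\<in>F i. C \<subseteq> C'"
    "\<And>i C x y. C \<in> F i \<Longrightarrow> x \<in> C \<Longrightarrow> y \<in> C \<Longrightarrow> dist x y < inverse (Suc i)"
    "\<And>i x. card {C \<in> F i. x \<in> C} \<le> d"
proof -
  from assms obtain F :: "nat \<Rightarrow> 'a set set" where F: "\<forall>i.
     locally_finite_in euclidean (F i) \<and> (\<forall>C\<in>F i. closed C) \<and> \<Union>(F i) = B \<and>
     (\<forall>C\<in>F (Suc i). \<exists>C'\<in>F i. C \<subseteq> C') \<and>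
     (\<forall>C\<in>F i. \<forall>x\<in>C. \<forall>y\<in>C. dist x y < inverse (Suc i)) \<and>
     (\<forall>x. card {C \<in> F i. x \<in> C} \<le> d)"
    unfolding cover_tower_def by (elim exE)
  show thesis
    by (rule that[of F]; use F in \<open>simp\<close>)
qed

lemma locally_finite_in_finite_members:
  assumes "locally_finite_in X \<A>" "x \<in> topspace X"
  shows "finite {C \<in> \<A>. x \<in> C}"
proof -
  obtain V where "x \<in> V" "finite {U \<in> \<A>. U \<inter> V \<noteq> {}}"
    using assms unfolding locally_finite_in_def by blast
  then show ?thesis
    by (rule_tac finite_subset[of _ "{U \<in> \<A>. U \<inter> V \<noteq> {}}"]) auto
qed

lemma cover_tower_closed:
  assumes "cover_tower d B"
  shows "closed B"
proof -
  obtain F where "locally_finite_in euclidean (F 0)" "\<And>C. C \<in> F 0 \<Longrightarrow> closed C" "\<Union>(F 0) = B"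
    by (rule cover_towerE[OF assms]) blast
  then show ?thesis
    using closedin_locally_finite_Union[of "F 0" euclidean] by simp
qed

lemma cover_tower_0_empty:
  fixes A :: "'a::metric_space set"
  assumes "cover_tower 0 A"
  shows "A = {}"
  using assms
proof (rule cover_towerE)
  fix F :: "nat \<Rightarrow> 'a set set" assume F: "\<And>i. locally_finite_in euclidean (F i)" "\<And>i. \<Union>(F i) = A"
    and card: "\<And>i x. card {C \<in> F i. x \<in> C} \<le> 0"
  show "A = {}"
  proof (rule ccontr)
    assume "A \<noteq> {}"
    then obtain x C where "C \<in> F 0" "x \<in> C"
      using F(2)[of 0] by blast
    moreover have "{C \<in> F 0. x \<in> C} = {}"
      using card[of 0 x] locally_finite_in_finite_members[OF F(1)[of 0], of x] by simp
    ultimately show False by blast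
  qed
qed

lemma card_image_members_le:
  assumes "finite {C \<in> \<A>. x \<in> C}"
  shows "card {C \<in> (\<lambda>C. C \<inter> L) ` \<A>. x \<in> C} \<le> card {C \<in> \<A>. x \<in> C}"
proof -
  have "{C \<in> (\<lambda>C. C \<inter> L) ` \<A>. x \<in> C} \<subseteq> (\<lambda>C. C \<inter> L) ` {C \<in> \<A>. x \<in> C}"
    by auto
  then show ?thesis
    using assms by (meson card_image_le card_mono finite_imageI le_trans)
qed

lemma cover_tower_closed_subset:
  assumes "cover_tower d B" "closed L" "L \<subseteq> B"
  shows "cover_tower d L"
proof -
  obtain F where F: "\<And>i. locally_finite_in euclidean (F i)" "\<And>i C. C \<in> F i \<Longrightarrow> closed C"
    "\<And>i. \<Union>(F i) = B" "\<And>i C. C \<in> F (Suc i) \<Longrightarrow> \<exists>C'\<in>F i. C \<subseteq> C'"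
    "\<And>i C x y. C \<in> F i \<Longrightarrow> x \<in> C \<Longrightarrow> y \<in> C \<Longrightarrow> dist x y < inverse (Suc i)"
    "\<And>i x. card {C \<in> F i. x \<in> C} \<le> d"
    using assms(1) by (rule cover_towerE) (rule that)
  define H where "H = (\<lambda>i. (\<lambda>K. K \<inter> L) ` F i)"
  show ?thesis
    unfolding cover_tower_def
  proof (intro exI[of _ H] allI conjI ballI)
    fix i
    show "locally_finite_in euclidean (H i)"
      unfolding H_def by (rule locally_finite_in_refinement[OF F(1)]) auto
    show "\<Union>(H i) = L"
      using F(3)[of i] assms by (auto simp: H_def)
    show "closed C" if "C \<in> H i" for C
      using that F(2) assms by (auto simp: H_def)
    show "\<exists>C'\<in>H i. C \<subseteq> C'" if C: "C \<in> H (Suc i)" for C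
    proof -
      obtain K where K: "K \<in> F (Suc i)" "C = K \<inter> L"
        using C by (auto simp: H_def)
      obtain K' where "K' \<in> F i" "K \<subseteq> K'"
        using F(4)[OF K(1)] by blast
      then show ?thesis
        using K by (intro bexI[of _ "K' \<inter> L"]) (auto simp: H_def)
    qed
    show "dist x y < inverse (Suc i)" if "C \<in> H i" "x \<in> C" "y \<in> C" for C x y
      using that F(5) by (auto simp: H_def)
    show "card {C \<in> H i. x \<in> C} \<le> d" for x
      using card_image_members_le[of "F i" x L] F(6)[of i x]
        locally_finite_in_finite_members[OF F(1)[of i], of x]
      unfolding H_def by simp
  qed
qed

text \<open>Each cover of the tower is divided into two classes, compatibly with refinement.  A point
common to the unions of both classes lies in a member of the second one, so at most \<open>d\<close> members
of the first class contain it.\<close>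

lemma cover_tower_split:
  fixes x y :: "'a::metric_space"
  assumes B: "cover_tower (Suc d) B" and xy: "x \<in> B" "y \<in> B" "x \<noteq> y"
  obtains B1 B2 where "closed B1" "closed B2" "B = B1 \<union> B2" "x \<notin> B2" "y \<notin> B1"
    "cover_tower d (B1 \<inter> B2)"
proof -
  obtain F where F: "\<And>i. locally_finite_in euclidean (F i)" "\<And>i C. C \<in> F i \<Longrightarrow> closed C"
    "\<And>i. \<Union>(F i) = B" "\<And>i C. C \<in> F (Suc i) \<Longrightarrow> \<exists>C'\<in>F i. C \<subseteq> C'"
    "\<And>i C x y. C \<in> F i \<Longrightarrow> x \<in> C \<Longrightarrow> y \<in> C \<Longrightarrow> dist x y < inverse (Suc i)"
    "\<And>i x. card {C \<in> F i. x \<in> C} \<le> Suc d"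
    using B by (rule cover_towerE) (rule that)
  \<comment> \<open>Starting the tower at \<open>i0\<close> makes the members too small to contain
    both \<open>x\<close> and \<open>y\<close>.\<close>
  obtain i0 where i0: "inverse (real (Suc i0)) < dist x y"
    using reals_Archimedean[of "dist x y"] xy by auto
  define G where "G = (\<lambda>i. F (i + i0))"
  define \<phi> where "\<phi> i C = (SOME C'. C' \<in> G i \<and> C \<subseteq> C')" for i C
  have \<phi>: "\<phi> i C \<in> G i \<and> C \<subseteq> \<phi> i C" if "C \<in> G (Suc i)" for i C
    unfolding \<phi>_def by (rule someI_ex) (use F(4)[of C "i + i0"] that in \<open>auto simp: G_def\<close>)
  \<comment> \<open>The class of a member is decided by its ancestor in the first cover: it belongs
    to \<open>C i\<close> iff the chain of parents \<phi> ends in a set containing \<open>x\<close>.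
    Hence both unions \<open>P\<close> and \<open>Q\<close> decrease with the stage.\<close>
  define C where "C = rec_nat {K \<in> G 0. x \<in> K} (\<lambda>i c. {K \<in> G (Suc i). \<phi> i K \<in> c})"
  have C0: "C 0 = {K \<in> G 0. x \<in> K}" and CS: "\<And>i. C (Suc i) = {K \<in> G (Suc i). \<phi> i K \<in> C i}"
    by (simp_all add: C_def)
  have CG: "C i \<subseteq> G i" for i
    by (cases i) (auto simp: C0 CS)
  define P where "P = (\<lambda>i. \<Union>(C i))"
  define Q where "Q = (\<lambda>i. \<Union>(G i - C i))"
  have PQ: "P i \<union> Q i = B" for i
    using F(3)[of "i+i0"] CG[of i] by (auto simp: P_def Q_def G_def)
  have P_Suc: "P (Suc i) \<subseteq> P i" for i
    using \<phi> by (fastforce simp: P_def CS)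
  have Q_Suc: "Q (Suc i) \<subseteq> Q i" for i
    using \<phi> by (fastforce simp: Q_def CS)
  have closed_Un: "closed (\<Union>\<A>)" if "\<A> \<subseteq> G i" for \<A> i
    using closedin_locally_finite_Union[of \<A> euclidean] locally_finite_in_subset[OF F(1) that[unfolded G_def]] that F(2)
    by (auto simp: G_def)
  define B1 where "B1 = (\<Inter>i. P i)"
  define B2 where "B2 = (\<Inter>i. Q i)"
  have cB1: "closed B1"
    unfolding B1_def P_def using CG closed_Un by (intro closed_INT) blast
  have cB2: "closed B2"
    unfolding B2_def Q_def using closed_Un by (intro closed_INT) blast
  have B12: "B = B1 \<union> B2"
  proof
    show "B1 \<union> B2 \<subseteq> B"
      using PQ unfolding B1_def B2_def by blast
    show "B \<subseteq> B1 \<union> B2"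
    proof
      fix z assume z: "z \<in> B"
      show "z \<in> B1 \<union> B2"
      proof (rule ccontr)
        assume "z \<notin> B1 \<union> B2"
        then obtain i j where ij: "z \<notin> P i" "z \<notin> Q j"
          unfolding B1_def B2_def by auto
        \<comment> \<open>The failures occur at possibly different stages; by monotonicity both
          persist at the later one, where the two unions together are \<open>B\<close>.\<close>
        have "P (max i j) \<subseteq> P i" "Q (max i j) \<subseteq> Q j"
          using lift_Suc_antimono_le[of P, OF P_Suc] lift_Suc_antimono_le[of Q, OF Q_Suc] by auto
        then show False
          using ij PQ[of "max i j"] z by blast
      qed
    qed
  qed
  have xB2: "x \<notin> B2"
    unfolding B2_def Q_def using C0 by (auto intro!: exI[of _ 0])
  have "y \<notin> P 0"
  proof
    assume "y \<in> P 0"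
    then obtain K where "K \<in> G 0" "x \<in> K" "y \<in> K"
      by (auto simp: P_def C0)
    then show False
      using F(5)[of K i0 x y] i0 by (auto simp: G_def)
  qed
  then have yB1: "y \<notin> B1"
    unfolding B1_def by blast
  have "cover_tower d (B1 \<inter> B2)"
  proof -
    let ?L = "B1 \<inter> B2"
    \<comment> \<open>Traces of the first class suffice, as it covers \<open>B1\<close> at every
      stage.\<close>
    define H where "H = (\<lambda>i. (\<lambda>K. K \<inter> ?L) ` C i)"
    show ?thesis
      unfolding cover_tower_def
    proof (intro exI[of _ H] allI conjI ballI)
      fix i
      have lf: "locally_finite_in euclidean (C i)"
        using locally_finite_in_subset[OF F(1)] CG[of i] unfolding G_def by blast
      show "locally_finite_in euclidean (H i)"
        unfolding H_def by (rule locally_finite_in_refinement[OF lf]) auto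
      show "\<Union>(H i) = ?L"
        by (auto simp: H_def B1_def P_def)
      show "closed K" if "K \<in> H i" for K
        using that F(2) CG[of i] cB1 cB2 by (auto simp: H_def G_def)
      show "\<exists>C'\<in>H i. K \<subseteq> C'" if K: "K \<in> H (Suc i)" for K
      proof -
        obtain K' where K': "K' \<in> G (Suc i)" "\<phi> i K' \<in> C i" "K = K' \<inter> ?L"
          using K by (auto simp: H_def CS)
        then show ?thesis
          using \<phi>[OF K'(1)] by (intro bexI[of _ "\<phi> i K' \<inter> ?L"]) (auto simp: H_def)
      qed
      show "dist u v < inverse (Suc i)" if K: "K \<in> H i" "u \<in> K" "v \<in> K" for K u v
      proof -
        have "dist u v < inverse (Suc (i + i0))"
          using K F(5)[of _ "i+i0" u v] CG[of i] by (auto simp: H_def G_def)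
        also have "\<dots> \<le> inverse (Suc i)"
          by (simp add: field_simps)
        finally show ?thesis .
      qed
      show "card {K \<in> H i. u \<in> K} \<le> d" for u
      proof (cases "u \<in> ?L")
        case False
        then have "{K \<in> H i. u \<in> K} = {}"
          by (auto simp: H_def)
        then show ?thesis by (metis card.empty zero_le)
      next
        case True
        then obtain K0 where K0: "K0 \<in> G i - C i" "u \<in> K0"
          unfolding B2_def Q_def by blast
        have fin: "finite {K \<in> G i. u \<in> K}"
          using locally_finite_in_finite_members[OF F(1)] by (simp add: G_def)
        have "{K \<in> C i. u \<in> K} \<subset> {K \<in> G i. u \<in> K}"
          using CG[of i] K0 by auto
        then have "card {K \<in> C i. u \<in> K} < card {K \<in> G i. u \<in> K}"
          using fin psubset_card_mono by blast
        also have "\<dots> \<le> Suc d"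
          using F(6) by (simp add: G_def)
        finally have "card {K \<in> C i. u \<in> K} \<le> d" by simp
        moreover have "finite {K \<in> C i. u \<in> K}"
          using fin CG[of i] by (rule_tac finite_subset[OF _ fin]) auto
        ultimately show ?thesis
          using card_image_members_le[of "C i" u ?L] unfolding H_def by simp
      qed
    qed
  qed
  with cB1 cB2 B12 xB2 yB1 show thesis
    using that by blast
qed

text \<open>Suppose that a cycle does not bound relative to the complement of \<open>A\<close>, and take a minimal
closed \<open>B \<subseteq> A\<close> with this property; it exists as chains have compact support.  If \<open>B\<close> had two points,
it would split into two proper closed subsets with an intersection of smaller dimension, against
Mayer--Vietoris.\<close>

lemma trivial_relative_homology_cover_tower:
  fixes X :: "'a::metric_space topology"
  assumes X: "X = subtopology euclidean U" "open U"
    and pt: "\<And>x k. x \<in> U \<Longrightarrow> k \<le> m \<Longrightarrow> trivial_group (relative_homology_group (int k) X (U - {x}))"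
    and A: "cover_tower d A" and k: "k + d \<le> Suc m"
  shows "trivial_group (relative_homology_group (int k) X (U - A))"
  using A k
proof (induction d arbitrary: A k)
  case 0
  have "A = {}"
    using cover_tower_0_empty 0 by blast
  then show ?case
    using trivial_relative_homology_group_topspace[of "int k" X] X by simp
next
  case (Suc d)
  show ?case
    unfolding trivial_relative_homology_group_iff
  proof (intro allI impI, rule ccontr)
    fix c assume c: "singular_relcycle k X (U - A) c" and nc: "\<not> singular_relboundary k X (U - A) c"
    define \<B> where "\<B> = {B. closed B \<and> B \<subseteq> A \<and> \<not> singular_relboundary k X (U - B) c}"
    have open_diff: "openin X (U - B)" if "closed B" for B
      using that X openin_open_subtopology[of euclidean U "U - B"] by (simp add: open_Diff)
    have "\<exists>B\<in>\<B>. \<forall>B'\<in>\<B>. B' \<subseteq> B \<longrightarrow> B' = B"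
    proof -
      \<comment> \<open>Zorn's lemma gives maximal sets, so it is applied to complements. These meet
        \<open>U\<close> in a chain of open sets, and if \<open>c\<close> bounded relative to the
        union, it would already bound relative to one of them.\<close>
      have "\<exists>Z\<in>uminus ` \<B>. \<forall>Z'\<in>uminus ` \<B>. Z \<subseteq> Z' \<longrightarrow> Z' = Z"
      proof (rule subset_Zorn_nonempty)
        show "uminus ` \<B> \<noteq> {}"
          using Suc.prems nc cover_tower_closed by (auto simp: \<B>_def)
        fix \<C> assume ne: "\<C> \<noteq> {}" and ch: "subset.chain (uminus ` \<B>) \<C>"
        define \<P> where "\<P> = (\<lambda>Z. U \<inter> Z) ` \<C>"
        have sub: "\<C> \<subseteq> uminus ` \<B>"
          using ch by (simp add: subset_chain_def)
        have inB: "- Z \<in> \<B>" if "Z \<in> \<C>" for Z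
          using sub that by auto
        have "- \<Union>\<C> \<in> \<B>"
        proof -
          have "closed (- \<Union>\<C>)"
            using inB by (auto simp: \<B>_def open_closed closed_Compl intro!: open_Union)
          moreover have "- \<Union>\<C> \<subseteq> A"
            using ne inB by (auto simp: \<B>_def)
          moreover have "\<not> singular_relboundary k X (U - - \<Union>\<C>) c"
          proof
            assume "singular_relboundary k X (U - - \<Union>\<C>) c"
            moreover have "U - - \<Union>\<C> = \<Union>\<P>"
              by (auto simp: \<P>_def)
            ultimately have "singular_relboundary k X (\<Union>\<P>) c" by simp
            then have "\<exists>P\<in>\<P>. singular_relboundary k X P c"
            proof (rule singular_relboundary_directed_Union[rotated -1])
              show "\<P> \<noteq> {}" using ne by (simp add: \<P>_def)
              show "openin X P" if P: "P \<in> \<P>" for P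
              proof -
                obtain Z where Z: "Z \<in> \<C>" "P = U - (- Z)"
                  using P by (auto simp: \<P>_def)
                then show ?thesis
                  using inB[of Z] open_diff[of "- Z"] by (simp add: \<B>_def)
              qed
              show "P \<subseteq> Q \<or> Q \<subseteq> P" if "P \<in> \<P>" "Q \<in> \<P>" for P Q
                using that ch unfolding \<P>_def subset_chain_def by blast
            qed
            then show False
              using inB by (auto simp: \<P>_def \<B>_def Diff_eq)
          qed
          ultimately show ?thesis
            by (simp add: \<B>_def)
        qed
        then show "\<Union>\<C> \<in> uminus ` \<B>"
          by (metis double_compl image_eqI)
      qed
      then show ?thesis by auto
    qed
    then obtain B where B: "B \<in> \<B>" and min: "\<And>B'. B' \<in> \<B> \<Longrightarrow> B' \<subseteq> B \<Longrightarrow> B' = B"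
      by blast
    have cB: "closed B" "B \<subseteq> A" and nB: "\<not> singular_relboundary k X (U - B) c"
      using B by (auto simp: \<B>_def)
    have cyc: "singular_relcycle k X (U - B) c"
      using singular_relcycle_mono[OF c] cB by blast
    have tB: "cover_tower (Suc d) B"
      using cover_tower_closed_subset[OF Suc.prems(1)] cB by blast
    have bd: "singular_relboundary k X (U - B') c" if "closed B'" "B' \<subset> B" for B'
      using min[of B'] that cB by (auto simp: \<B>_def)
    \<comment> \<open>A chain of \<open>U\<close> bounds relative to all of \<open>U\<close>, so
      \<open>B\<close> must meet \<open>U\<close>. The point \<open>x\<close> is taken there, where
      the hypothesis on points applies; the second point \<open>y\<close> may lie anywhere in
      \<open>B\<close>.\<close>
    have "singular_chain k X c"
      using c by (simp add: singular_relcycle_def)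
    then have "singular_relboundary k X U c"
      using singular_chain_imp_relboundary[of k X U c] X by (simp add: subtopology_subtopology)
    then have "B \<inter> U \<noteq> {}"
      using nB by (auto simp: Diff_triv Int_commute)
    then obtain x where x: "x \<in> B" "x \<in> U" by blast
    show False
    proof (cases "B = {x}")
      case True
      \<comment> \<open>The bound \<open>k + Suc d \<le> Suc m\<close> gives
        \<open>k \<le> m\<close>, the range of the hypothesis on points.\<close>
      then have "trivial_group (relative_homology_group (int k) X (U - B))"
        using pt[of x k] Suc.prems x by auto
      then show False
        using cyc nB trivial_relative_homology_group_iff by blast
    next
      case False
      then obtain y where y: "y \<in> B" "x \<noteq> y"
        using x by blast
      obtain B1 B2 where split: "closed B1" "closed B2" "B = B1 \<union> B2" "x \<notin> B2" "y \<notin> B1"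
          "cover_tower d (B1 \<inter> B2)"
        using cover_tower_split[OF tB x(1) y] .
      \<comment> \<open>Mayer--Vietoris asks for the union of the two complements one degree higher,
        where the smaller tower on \<open>B1 \<inter> B2\<close> compensates.\<close>
      have "trivial_group (relative_homology_group (int (Suc k)) X (U - (B1 \<inter> B2)))"
        using cB split Suc.prems by (intro Suc.IH[OF split(6)]) auto
      moreover have "(U - B1) \<union> (U - B2) = U - (B1 \<inter> B2)" "(U - B1) \<inter> (U - B2) = U - B"
        using split by auto
      moreover have "singular_relboundary k X (U - B1) c" "singular_relboundary k X (U - B2) c"
        using bd[of B1] bd[of B2] split x y by auto
      ultimately have "singular_relboundary k X (U - B) c"
        using singular_relboundary_Int[OF open_diff[OF split(1)] open_diff[OF split(2)], of k c] cyc by simp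
      then show False using nB by blast
    qed
  qed
qed

section \<open>From finite covers to towers\<close>

lemma covering_dim_leD:
  assumes "covering_dim_le X n" "finite \<U>" "\<forall>U\<in>\<U>. openin X U" "\<Union>\<U> = topspace X"
  shows "\<exists>\<V>. finite \<V> \<and> (\<forall>V\<in>\<V>. openin X V) \<and> \<Union>\<V> = topspace X \<and>
             (\<forall>V\<in>\<V>. \<exists>U\<in>\<U>. V \<subseteq> U) \<and> (\<forall>x\<in>topspace X. int (card {V\<in>\<V>. x \<in> V}) \<le> n + 1)"
proof -
  have "\<forall>\<U>. finite \<U> \<and> (\<forall>U\<in>\<U>. openin X U) \<and> \<Union>\<U> = topspace X \<longrightarrow>
        (\<exists>\<V>. finite \<V> \<and> (\<forall>V\<in>\<V>. openin X V) \<and> \<Union>\<V> = topspace X \<and>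
             (\<forall>V\<in>\<V>. \<exists>U\<in>\<U>. V \<subseteq> U) \<and> (\<forall>x\<in>topspace X. int (card {V\<in>\<V>. x \<in> V}) \<le> n + 1))"
    using assms(1) unfolding covering_dim_le_def by (rule conjunct2)
  from this[rule_format, of \<U>] show ?thesis
    using assms(2-4) by simp
qed

text \<open>Each member of a refinement is assigned to one index, and members with the same index
  are united. The order does not grow, since the indices at a point are images of the refining
  members at that point. Keeping the index set fixed allows a cover to be corrected
  repeatedly.\<close>

lemma covering_dim_le_indexed:
  assumes X: "covering_dim_le X n" and "finite I" and U: "\<And>i. i \<in> I \<Longrightarrow> openin X (U i)"
    and cover: "(\<Union>i\<in>I. U i) = topspace X"
  obtains W where "\<And>i. i \<in> I \<Longrightarrow> openin X (W i)" "\<And>i. i \<in> I \<Longrightarrow> W i \<subseteq> U i"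
    "(\<Union>i\<in>I. W i) = topspace X"
    "\<And>x. x \<in> topspace X \<Longrightarrow> int (card {i \<in> I. x \<in> W i}) \<le> n + 1"
proof -
  have "finite (U ` I)" "\<forall>V\<in>U ` I. openin X V" "\<Union>(U ` I) = topspace X"
    using assms by auto
  from covering_dim_leD[OF X this] obtain \<V> where \<V>: "finite \<V>" "\<forall>V\<in>\<V>. openin X V" "\<Union>\<V> = topspace X"
    "\<forall>V\<in>\<V>. \<exists>U'\<in>U ` I. V \<subseteq> U'" "\<forall>x\<in>topspace X. int (card {V\<in>\<V>. x \<in> V}) \<le> n + 1"
    by (elim exE conjE)
  define \<phi> where "\<phi> = (\<lambda>V. SOME i. i \<in> I \<and> V \<subseteq> U i)"
  have \<phi>: "\<phi> V \<in> I \<and> V \<subseteq> U (\<phi> V)" if "V \<in> \<V>" for V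
    unfolding \<phi>_def by (rule someI_ex) (use \<V>(4) that in auto)
  define W where "W = (\<lambda>i. \<Union>{V \<in> \<V>. \<phi> V = i})"
  show thesis
  proof (rule that[of W])
    show "openin X (W i)" for i
      unfolding W_def using \<V> by auto
    show "W i \<subseteq> U i" for i
      unfolding W_def using \<phi> by auto
    have "(\<Union>i\<in>I. W i) = \<Union>\<V>"
      unfolding W_def using \<phi> by blast
    then show "(\<Union>i\<in>I. W i) = topspace X"
      using \<V>(3) by simp
    fix x assume x: "x \<in> topspace X"
    have "{i \<in> I. x \<in> W i} \<subseteq> \<phi> ` {V \<in> \<V>. x \<in> V}"
      unfolding W_def by auto
    then have "card {i \<in> I. x \<in> W i} \<le> card {V \<in> \<V>. x \<in> V}"
      using \<V>(1) by (intro surj_card_le) auto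
    then show "int (card {i \<in> I. x \<in> W i}) \<le> n + 1"
      using \<V>(5) x by fastforce
  qed
qed

text \<open>Adding the open complement of \<open>K\<close> to every member turns a cover of
  \<open>K\<close> into one of \<open>X\<close>, and a refinement of small order is traced back on
  \<open>K\<close>. The enlarged sets cover only if there is at least one of them, hence the
  separate case of the empty cover.\<close>

lemma covering_dim_le_closed_subtopology:
  assumes X: "covering_dim_le X n" and K: "closedin X K"
  shows "covering_dim_le (subtopology X K) n"
proof -
  have top: "topspace (subtopology X K) = K"
    using K closedin_subset by auto
  have n: "n \<ge> -1"
    using X by (simp add: covering_dim_le_def)
  have "\<exists>\<V>. finite \<V> \<and> (\<forall>V\<in>\<V>. openin (subtopology X K) V) \<and> \<Union>\<V> = K \<and>
             (\<forall>V\<in>\<V>. \<exists>U\<in>\<U>. V \<subseteq> U) \<and> (\<forall>x\<in>K. int (card {V\<in>\<V>. x \<in> V}) \<le> n + 1)"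
    if \<U>: "finite \<U>" "\<forall>U\<in>\<U>. openin (subtopology X K) U" "\<Union>\<U> = K" for \<U>
  proof (cases "\<U> = {}")
    case True
    then show ?thesis
      using \<U> n by (intro exI[of _ "{}"]) auto
  next
    case False
    have "openin X ((topspace X - K) \<union> U)" if "U \<in> \<U>" for U
    proof -
      obtain T where T: "openin X T" "U = T \<inter> K"
        using \<U> \<open>U \<in> \<U>\<close> by (auto simp: openin_subtopology)
      have "(topspace X - K) \<union> U = (topspace X - K) \<union> T"
        using T openin_subset by auto
      then show ?thesis
        using T K by auto
    qed
    moreover have "(\<Union>U\<in>\<U>. (topspace X - K) \<union> U) = topspace X"
      using False \<U>(3) K closedin_subset by auto
    ultimately obtain W where W: "\<And>U. U \<in> \<U> \<Longrightarrow> openin X (W U)"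
        "\<And>U. U \<in> \<U> \<Longrightarrow> W U \<subseteq> (topspace X - K) \<union> U" "(\<Union>U\<in>\<U>. W U) = topspace X"
        "\<And>x. x \<in> topspace X \<Longrightarrow> int (card {U \<in> \<U>. x \<in> W U}) \<le> n + 1"
      using covering_dim_le_indexed[OF X \<U>(1), of "\<lambda>U. (topspace X - K) \<union> U"] by blast
    define \<V> where "\<V> = (\<lambda>U. W U \<inter> K) ` \<U>"
    have "int (card {V\<in>\<V>. x \<in> V}) \<le> n + 1" if x: "x \<in> K" for x
    proof -
      have "{V\<in>\<V>. x \<in> V} \<subseteq> (\<lambda>U. W U \<inter> K) ` {U \<in> \<U>. x \<in> W U}"
        by (auto simp: \<V>_def)
      then have "card {V\<in>\<V>. x \<in> V} \<le> card {U \<in> \<U>. x \<in> W U}"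
        using \<U>(1) by (intro surj_card_le) auto
      moreover have "x \<in> topspace X"
        using x K closedin_subset by auto
      ultimately show ?thesis
        using W(4)[of x] by linarith
    qed
    moreover have "\<Union>\<V> = K"
      using W(3) K closedin_subset by (fastforce simp: \<V>_def)
    moreover have "\<exists>U\<in>\<U>. V \<subseteq> U" if "V \<in> \<V>" for V
      using that W(2) by (auto simp: \<V>_def)
    moreover have "openin (subtopology X K) V" if "V \<in> \<V>" for V
      using that W(1) by (auto simp: \<V>_def openin_subtopology)
    moreover have "finite \<V>"
      using \<U>(1) by (simp add: \<V>_def)
    ultimately show ?thesis
      by (intro exI[of _ \<V>] conjI ballI) assumption+
  qed
  then show ?thesis
    unfolding covering_dim_le_def top using n by (intro conjI allI impI) simp_all
qed

text \<open>The order is lowered on \<open>K\<close> while nothing changes elsewhere, so corrections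
  on different closed sets do not spoil each other. As only finitely many members meet
  \<open>K\<close>, the definition by finite covers applies on \<open>K\<close>; removing from
  \<open>W j\<close> the points of \<open>K\<close> outside the trace \<open>S j\<close> leaves an
  open set.\<close>

lemma covering_dim_le_shrink_on_closed:
  fixes W :: "nat \<Rightarrow> 'a set"
  assumes X: "covering_dim_le X n" and K: "closedin X K"
    and W: "\<And>j. openin X (W j)" "(\<Union>j. W j) = topspace X" and N: "\<And>j. j > N \<Longrightarrow> W j \<inter> K = {}"
  obtains W' where "\<And>j. openin X (W' j)" "(\<Union>j. W' j) = topspace X" "\<And>j. W' j \<subseteq> W j"
    "\<And>j. W' j - K = W j - K" "\<And>x. x \<in> K \<Longrightarrow> int (card {j. x \<in> W' j}) \<le> n + 1"
proof -
  let ?X = "subtopology X K"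
  have KX: "K \<subseteq> topspace X"
    using K closedin_subset by auto
  have XK: "covering_dim_le ?X n"
    using covering_dim_le_closed_subtopology[OF X K] .
  have op: "openin ?X (K \<inter> W j)" for j
    using W by (simp add: openin_subtopology_Int2)
  have "(\<Union>j\<in>{..N}. K \<inter> W j) = topspace ?X"
  proof
    show "topspace ?X \<subseteq> (\<Union>j\<in>{..N}. K \<inter> W j)"
    proof
      fix x assume "x \<in> topspace ?X"
      then have x: "x \<in> K" "x \<in> (\<Union>j. W j)"
        using W(2) by auto
      then obtain j where "x \<in> W j" by blast
      then show "x \<in> (\<Union>j\<in>{..N}. K \<inter> W j)"
        using x N[of j] by (cases "j \<le> N") auto
    qed
  qed (use KX in auto)
  then obtain S where S: "\<And>j. j \<in> {..N} \<Longrightarrow> openin ?X (S j)" "\<And>j. j \<in> {..N} \<Longrightarrow> S j \<subseteq> K \<inter> W j"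
    "(\<Union>j\<in>{..N}. S j) = topspace ?X"
    "\<And>x. x \<in> topspace ?X \<Longrightarrow> int (card {j \<in> {..N}. x \<in> S j}) \<le> n + 1"
    using covering_dim_le_indexed[OF XK, of "{..N}" "\<lambda>j. K \<inter> W j"] op by blast
  define T where "T = (\<lambda>j. SOME T. openin X T \<and> S j = T \<inter> K)"
  have T: "openin X (T j) \<and> S j = T j \<inter> K" if "j \<le> N" for j
    unfolding T_def by (rule someI_ex) (use S(1)[of j] that in \<open>auto simp: openin_subtopology\<close>)
  define W' where "W' = (\<lambda>j. if j \<le> N then W j \<inter> ((topspace X - K) \<union> T j) else W j)"
  have W'K: "W' j \<inter> K = (if j \<le> N then S j else {})" for j
    using T[of j] S(2)[of j] N[of j] by (auto simp: W'_def)
  have W'D: "W' j - K = W j - K" for j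
    using openin_subset[OF W(1), of j] by (auto simp: W'_def)
  show thesis
  proof (rule that[of W'])
    show "openin X (W' j)" for j
      using W(1)[of j] T[of j] K unfolding W'_def by (auto intro!: openin_Int openin_Un)
    show sub: "W' j \<subseteq> W j" for j
      by (auto simp: W'_def)
    show "W' j - K = W j - K" for j
      by (rule W'D)
    show "(\<Union>j. W' j) = topspace X"
    proof
      show "(\<Union>j. W' j) \<subseteq> topspace X"
        using sub W(2) by blast
      show "topspace X \<subseteq> (\<Union>j. W' j)"
      proof
        fix x assume x: "x \<in> topspace X"
        show "x \<in> (\<Union>j. W' j)"
        proof (cases "x \<in> K")
          case True
          then have "x \<in> (\<Union>j\<in>{..N}. S j)"
            using S(3) x by auto
          then obtain j where "j \<le> N" "x \<in> S j" by auto
          then show ?thesis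
            using W'K[of j] by auto
        next
          case False
          then show ?thesis
            using W(2) W'D x by blast
        qed
      qed
    qed
    fix x assume x: "x \<in> K"
    have "x \<in> W' j \<longleftrightarrow> j \<le> N \<and> x \<in> S j" for j
      using W'K[of j] x by (cases "j \<le> N") auto
    then have "{j. x \<in> W' j} = {j \<in> {..N}. x \<in> S j}"
      by auto
    then show "int (card {j. x \<in> W' j}) \<le> n + 1"
      using S(4)[of x] x KX by auto
  qed
qed

section \<open>Countable open covers\<close>

lemma infdist_complement_pos_iff:
  assumes "openin (top_of_set A) V" "x \<in> A"
  shows "(if A \<subseteq> V then 1 else infdist x (A - V)) > 0 \<longleftrightarrow> x \<in> V"
proof (cases "A \<subseteq> V")
  case False
  have cl: "closedin (top_of_set A) (A - V)"
    using assms by (simp add: closedin_diff)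
  then obtain C where C: "closed C" "A - V = A \<inter> C"
    by (auto simp: closedin_closed)
  have "x \<in> closure (A - V) \<longleftrightarrow> x \<in> A - V"
  proof
    assume "x \<in> closure (A - V)"
    then have "x \<in> C"
      using C by (metis closure_minimal inf_le2 subsetD)
    then show "x \<in> A - V" using C assms by blast
  qed (rule subsetD[OF closure_subset])
  then show ?thesis
    using False in_closure_iff_infdist_zero[of "A - V" x] infdist_nonneg[of x "A - V"] assms(2)
    by (auto simp: less_le)
qed (use assms in auto)

text \<open>Dowker's theorem for countable covers: on the rings \<open>K i\<close> between consecutive members of an
exhaustion by closed sets only finitely many members of the cover matter, so the cover can be
corrected on one ring after the other.\<close>

lemma covering_dim_le_countable_cover:
  fixes A :: "'a::metric_space set" and V :: "nat \<Rightarrow> 'a set"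
  assumes dim: "covering_dim_le (top_of_set A) n"
    and V: "\<And>j. openin (top_of_set A) (V j)" and cover: "(\<Union>j. V j) = A"
  obtains W where "\<And>j. openin (top_of_set A) (W j)" "\<And>j. W j \<subseteq> V j" "(\<Union>j. W j) = A"
    "\<And>x. x \<in> A \<Longrightarrow> \<exists>N. openin (top_of_set A) N \<and> x \<in> N \<and> finite {j. W j \<inter> N \<noteq> {}}"
    "\<And>x. x \<in> A \<Longrightarrow> finite {j. x \<in> W j} \<and> int (card {j. x \<in> W j}) \<le> n + 1"
proof -
  let ?X = "top_of_set A"
  \<comment> \<open>The value 1 is used because \<open>infdist\<close> to the empty set is 0; thus
    \<open>g j\<close> is positive exactly on \<open>V j\<close> in every case.\<close>
  define g where "g = (\<lambda>j x. if A \<subseteq> V j then 1 else infdist x (A - V j))"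
  have g_pos: "g j x > 0 \<longleftrightarrow> x \<in> V j" if "x \<in> A" for j x
    using infdist_complement_pos_iff[OF V that] by (simp add: g_def)
  have g_cont: "continuous_on A (g j)" for j
    unfolding g_def by (cases "A \<subseteq> V j") (auto intro!: continuous_intros)
  \<comment> \<open>\<open>G i\<close> is open, \<open>H i\<close> is closed, and both lie in the
    union of the first \<open>Suc i\<close> members. A large \<open>i\<close> admits the member
    containing a given point and also lowers the threshold below the value there.\<close>
  define G where "G = (\<lambda>i. \<Union>j\<in>{..i}. {x \<in> A. inverse (real (Suc i)) < g j x})"
  define H where "H = (\<lambda>i. \<Union>j\<in>{..i}. {x \<in> A. inverse (real (Suc i)) \<le> g j x})"
  have G_open: "openin ?X (G i)" for i
    unfolding G_def
    using continuous_openin_preimage_gen[OF g_cont, of "{inverse (real (Suc i))<..}"]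
    by (intro openin_Union) (auto simp: vimage_def Int_def)
  have H_closed: "closedin ?X (H i)" for i
    unfolding H_def
    using continuous_closedin_preimage[OF g_cont, of "{inverse (real (Suc i))..}"]
    by (intro closedin_Union) (auto simp: vimage_def Int_def)
  have GH: "G i \<subseteq> H i" for i
    by (force simp: G_def H_def)
  have HV: "H i \<subseteq> (\<Union>j\<in>{..i}. V j)" for i
  proof
    fix x assume "x \<in> H i"
    then obtain j where "j \<le> i" "x \<in> A" "inverse (real (Suc i)) \<le> g j x"
      by (auto simp: H_def)
    moreover have "0 < inverse (real (Suc i))" by simp
    ultimately show "x \<in> (\<Union>j\<in>{..i}. V j)"
      using g_pos[of x j] by (metis UN_I atMost_iff less_le_trans)
  qed
  have G_cover: "\<exists>i. x \<in> G i" if x: "x \<in> A" for x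
  proof -
    obtain j where "x \<in> V j" using cover x by blast
    then have "g j x > 0" using g_pos x by blast
    then obtain k where k: "inverse (real (Suc k)) < g j x"
      using reals_Archimedean by blast
    have "inverse (real (Suc (max j k))) \<le> inverse (real (Suc k))"
      by (simp add: field_simps)
    then have "inverse (real (Suc (max j k))) < g j x"
      using k by linarith
    then have "x \<in> G (max j k)"
      using x unfolding G_def by (intro UN_I[of j]) auto
    then show ?thesis ..
  qed
  \<comment> \<open>Deleting \<open>H i\<close> from all members of index above \<open>i\<close>
    makes the cover locally finite. No point is lost: if \<open>j\<close> is the first index with
    \<open>x\<close> in \<open>V j\<close>, then \<open>x\<close> lies in no \<open>H i\<close> with
    \<open>i < j\<close>.\<close>
  define V' where "V' = (\<lambda>j. V j - (\<Union>i\<in>{..<j}. H i))"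
  have V'_open: "openin ?X (V' j)" for j
    unfolding V'_def using V H_closed by (intro openin_diff closedin_Union) auto
  have V'_cover: "(\<Union>j. V' j) = A"
  proof
    show "(\<Union>j. V' j) \<subseteq> A"
      using cover by (auto simp: V'_def)
    show "A \<subseteq> (\<Union>j. V' j)"
    proof
      fix x assume "x \<in> A"
      then have ex: "\<exists>j. x \<in> V j" using cover by blast
      define j where "j = (LEAST j. x \<in> V j)"
      have "x \<in> V j"
        unfolding j_def using ex by (rule LeastI_ex)
      moreover have "x \<notin> V k" if "k < j" for k
        using that not_less_Least unfolding j_def by blast
      ultimately have "x \<in> V' j"
        unfolding V'_def using HV by fastforce
      then show "x \<in> (\<Union>j. V' j)" by blast
    qed
  qed
  \<comment> \<open>The ring \<open>K i\<close> misses \<open>V' j\<close> for \<open>j > i\<close>,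
    so a correction on it concerns finitely many members. It misses \<open>G l\<close> for
    \<open>l < i\<close>, so the corrections become constant on each \<open>G l\<close>.\<close>
  define K where "K = (\<lambda>i. H i - (\<Union>l\<in>{..<i}. G l))"
  have K_closed: "closedin ?X (K i)" for i
    unfolding K_def using H_closed G_open by (intro closedin_diff openin_Union) auto
  have K_cover: "\<exists>i. x \<in> K i" if "x \<in> A" for x
  proof -
    have ex: "\<exists>i. x \<in> H i" using G_cover[OF that] GH by blast
    define i where "i = (LEAST i. x \<in> H i)"
    have "x \<in> H i"
      unfolding i_def using ex by (rule LeastI_ex)
    moreover have "x \<notin> H k" if "k < i" for k
      using that not_less_Least unfolding i_def by blast
    ultimately show ?thesis
      using GH by (auto simp: K_def)
  qed
  have KG: "x \<notin> K i" if "x \<in> G l" "l < i" for x i l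
    using that by (auto simp: K_def)
  have V'K: "V' j \<inter> K i = {}" if "i < j" for i j
    using that by (auto simp: V'_def K_def)
  define P where "P = (\<lambda>W :: nat \<Rightarrow> 'a set. (\<forall>j. openin ?X (W j) \<and> W j \<subseteq> V' j) \<and> (\<Union>j. W j) = A)"
  define Q where "Q = (\<lambda>i (W :: nat \<Rightarrow> 'a set) W'. (\<forall>j. W' j \<subseteq> W j \<and> W' j - K i = W j - K i)
       \<and> (\<forall>x\<in>K i. int (card {j. x \<in> W' j}) \<le> n + 1))"
  have "\<exists>f. \<forall>i. P (f i) \<and> Q i (f i) (f (Suc i))"
  proof (rule dependent_nat_choice)
    show "\<exists>W. P W"
      unfolding P_def by (rule exI[of _ V']) (use V'_open V'_cover in blast)
    fix W i assume "P W"
    then have W: "\<And>j. openin ?X (W j)" "\<And>j. W j \<subseteq> V' j" "(\<Union>j. W j) = A"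
      by (auto simp: P_def)
    have dis: "W j \<inter> K i = {}" if "j > i" for j
      using W(2)[of j] V'K[OF that] by blast
    have top: "(\<Union>j. W j) = topspace ?X"
      using W(3) by simp
    obtain W' where "\<And>j. openin ?X (W' j)" "(\<Union>j. W' j) = topspace ?X" "\<And>j. W' j \<subseteq> W j"
        "\<And>j. W' j - K i = W j - K i" "\<And>x. x \<in> K i \<Longrightarrow> int (card {j. x \<in> W' j}) \<le> n + 1"
      by (rule covering_dim_le_shrink_on_closed[where N = i, OF dim K_closed[of i] W(1) top])
         (erule dis, rule that)
    then show "\<exists>W'. P W' \<and> Q i W W'"
      using W(2) unfolding P_def Q_def
      by (intro exI[of _ W'] conjI allI ballI) (assumption | simp | blast)+
  qed
  then obtain f where f: "\<And>i. P (f i)" "\<And>i. Q i (f i) (f (Suc i))"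
    by blast
  have f_open: "openin ?X (f i j)" and fV': "f i j \<subseteq> V' j" and f_cover: "(\<Union>j. f i j) = A" for i j
    using f(1)[of i] by (simp_all add: P_def)
  have f_Suc: "f (Suc i) j \<subseteq> f i j" and fK: "f (Suc i) j - K i = f i j - K i" for i j
    using f(2)[of i] by (simp_all add: Q_def)
  have f_card: "int (card {j. x \<in> f (Suc i) j}) \<le> n + 1" if "x \<in> K i" for x i
    using f(2)[of i] that by (simp add: Q_def)
  define W where "W = (\<lambda>j. \<Inter>i. f i j)"
  \<comment> \<open>On \<open>G l\<close> only the rings \<open>K 0\<close> to \<open>K l\<close>
    matter, so nothing changes after stage \<open>Suc l\<close>. This is why the infinite
    intersection \<open>W j\<close> is still open and the sets \<open>W j\<close> still
    cover.\<close>
  have WG: "W j \<inter> G l = f (Suc l) j \<inter> G l" for j l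
  proof -
    have const: "x \<in> f i j" if "x \<in> G l" "x \<in> f (Suc l) j" "Suc l \<le> i" for x i
      using that(3)
    proof (induction i rule: dec_induct)
      case base then show ?case using that by blast
    next
      case (step i)
      then show ?case using fK[of i j] KG[OF that(1), of i] by auto
    qed
    have "x \<in> f i j" if "x \<in> G l" "x \<in> f (Suc l) j" for x i
    proof (cases "Suc l \<le> i")
      case True then show ?thesis using const that by blast
    next
      case False
      then have "f (Suc l) j \<subseteq> f i j"
        using lift_Suc_antimono_le[of "\<lambda>i. f i j", OF f_Suc, of i "Suc l"] by simp
      then show ?thesis using that by blast
    qed
    then show ?thesis
      unfolding W_def by blast
  qed
  have W_A: "W j \<subseteq> A" for j
    using f_cover[of 0] unfolding W_def by blast
  show thesis
  proof (rule that[of W])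
    show "openin ?X (W j)" for j
    proof -
      have "W j = (\<Union>l. f (Suc l) j \<inter> G l)"
      proof
        show "W j \<subseteq> (\<Union>l. f (Suc l) j \<inter> G l)"
        proof
          fix x assume x: "x \<in> W j"
          then obtain l where "x \<in> G l"
            using W_A[of j] G_cover by blast
          then show "x \<in> (\<Union>l. f (Suc l) j \<inter> G l)"
            using WG[of j l] x by blast
        qed
      qed (use WG[of j] in blast)
      then show ?thesis
        by (simp only:) (intro openin_Union, clarify, intro openin_Int f_open G_open)
    qed
    show "W j \<subseteq> V j" for j
      using fV'[of 0 j] by (auto simp: W_def V'_def)
    show "(\<Union>j. W j) = A"
    proof
      show "A \<subseteq> (\<Union>j. W j)"
      proof
        fix x assume "x \<in> A"
        then obtain l where l: "x \<in> G l" using G_cover by blast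
        obtain j where "x \<in> f (Suc l) j"
          using f_cover[of "Suc l"] \<open>x \<in> A\<close> by blast
        then show "x \<in> (\<Union>j. W j)" using WG[of j l] l by blast
      qed
    qed (use W_A in blast)
    show "\<exists>N. openin ?X N \<and> x \<in> N \<and> finite {j. W j \<inter> N \<noteq> {}}" if x: "x \<in> A" for x
    proof -
      obtain l where l: "x \<in> G l" using G_cover x by blast
      have "j \<le> l" if "W j \<inter> G l \<noteq> {}" for j
      proof (rule ccontr)
        assume "\<not> j \<le> l"
        then have "V' j \<inter> H l = {}" by (auto simp: V'_def)
        moreover have "W j \<subseteq> V' j"
          using fV'[of 0 j] by (auto simp: W_def)
        ultimately show False using that GH[of l] by blast
      qed
      then have "{j. W j \<inter> G l \<noteq> {}} \<subseteq> {..l}"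
        by blast
      then have "finite {j. W j \<inter> G l \<noteq> {}}"
        by (rule finite_subset) simp
      then show ?thesis using l G_open by blast
    qed
    show "finite {j. x \<in> W j} \<and> int (card {j. x \<in> W j}) \<le> n + 1" if "x \<in> A" for x
    proof -
      obtain i where i: "x \<in> K i" using K_cover \<open>x \<in> A\<close> by blast
      \<comment> \<open>Finiteness is needed beside the bound: without it \<open>card\<close> could
        be 0 at a point of infinitely many members.\<close>
      have "{j. x \<in> f (Suc i) j} \<subseteq> {..i}"
      proof
        fix j assume "j \<in> {j. x \<in> f (Suc i) j}"
        then have "x \<in> V' j" using fV'[of "Suc i" j] by blast
        then have "\<not> i < j" using V'K[of i j] i by blast
        then show "j \<in> {..i}" by simp
      qed
      then have fin: "finite {j. x \<in> f (Suc i) j}"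
        using finite_subset by blast
      have sub: "{j. x \<in> W j} \<subseteq> {j. x \<in> f (Suc i) j}"
        by (auto simp: W_def)
      then have "card {j. x \<in> W j} \<le> card {j. x \<in> f (Suc i) j}"
        using fin card_mono by blast
      then show ?thesis
        using f_card[OF i] fin finite_subset[OF sub] by linarith
    qed
  qed
qed

section \<open>Arbitrary open covers of a metric space\<close>

text \<open>Stone's construction: \<open>E n U\<close> is a neighbourhood of the points that lie well inside \<open>U\<close> but
in no earlier member of the cover.\<close>

lemma sigma_discrete_refinement:
  fixes A :: "'a::metric_space set"
  assumes \<U>: "\<And>U. U \<in> \<U> \<Longrightarrow> openin (top_of_set A) U" and cover: "\<Union>\<U> = A"
  obtains E :: "nat \<Rightarrow> 'a set \<Rightarrow> 'a set" and e :: "nat \<Rightarrow> real" where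
    "\<And>n U. openin (top_of_set A) (E n U)" "\<And>n U. U \<in> \<U> \<Longrightarrow> E n U \<subseteq> U"
    "(\<Union>n. \<Union>U\<in>\<U>. E n U) = A" "\<And>n. e n > 0"
    "\<And>n U U' x y. U \<in> \<U> \<Longrightarrow> U' \<in> \<U> \<Longrightarrow> U \<noteq> U' \<Longrightarrow> x \<in> E n U \<Longrightarrow> y \<in> E n U' \<Longrightarrow> dist x y \<ge> e n"
proof -
  obtain r where r: "well_order_on \<U> r"
    using well_order_on by blast
  define \<delta> where "\<delta> n = inverse (real (Suc n))" for n
  have \<delta>: "\<delta> n > 0" for n
    by (simp add: \<delta>_def)
  define C where "C n U = {x \<in> A. (\<forall>y\<in>A. dist x y < \<delta> n \<longrightarrow> y \<in> U) \<and>
     (\<forall>W\<in>\<U>. (W, U) \<in> r \<and> W \<noteq> U \<longrightarrow> x \<notin> W)}" for n U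
  \<comment> \<open>A third of the distance on either side leaves a third as the gap between
    different sets.\<close>
  define E where "E n U = A \<inter> (\<Union>x\<in>C n U. ball x (\<delta> n / 3))" for n U
  \<comment> \<open>The well-order breaks the symmetry: a point of \<open>C n U\<close> has its
    whole \<delta>-neighbourhood in the earlier set \<open>U\<close>, whereas a point of
    \<open>C n U'\<close> avoids all sets before \<open>U'\<close>.\<close>
  have gap: "dist x y \<ge> \<delta> n" if "(U, U') \<in> r" "U \<in> \<U>" "U \<noteq> U'" "x \<in> C n U" "y \<in> C n U'" for n U U' x y
  proof (rule ccontr)
    assume "\<not> \<delta> n \<le> dist x y"
    then have "y \<in> U"
      using that by (auto simp: C_def)
    then show False
      using that by (auto simp: C_def)
  qed
  have tot: "(U, U') \<in> r \<or> (U', U) \<in> r" if "U \<in> \<U>" "U' \<in> \<U>" "U \<noteq> U'" for U U'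
    using r that by (auto simp: well_order_on_def linear_order_on_def total_on_def)
  have EU: "E n U \<subseteq> U" for n U
  proof
    fix y assume "y \<in> E n U"
    then obtain x where "y \<in> A" "x \<in> C n U" "dist x y < \<delta> n / 3"
      by (auto simp: E_def)
    moreover have "\<delta> n / 3 < \<delta> n" using \<delta>[of n] by simp
    ultimately show "y \<in> U"
      by (auto simp: C_def)
  qed
  show thesis
  proof (rule that[of E "\<lambda>n. \<delta> n / 3"])
    show "openin (top_of_set A) (E n U)" for n U
      unfolding E_def by (intro openin_open_Int open_UN ballI open_ball)
    show "E n U \<subseteq> U" for n U
      by (rule EU)
    show "\<delta> n / 3 > 0" for n
      using \<delta> by simp
    show "(\<Union>n. \<Union>U\<in>\<U>. E n U) = A"
    proof
      show "A \<subseteq> (\<Union>n. \<Union>U\<in>\<U>. E n U)"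
      proof
        fix x assume x: "x \<in> A"
        \<comment> \<open>The first member containing \<open>x\<close> serves as \<open>U\<close>,
          with \<open>n\<close> so large that the \<delta>-ball about \<open>x\<close> stays inside
          it.\<close>
        have "wf (r - Id)"
          using r by (simp add: well_order_on_def)
        moreover obtain U0 where "U0 \<in> {U \<in> \<U>. x \<in> U}"
          using cover x by blast
        ultimately obtain U where U: "U \<in> {U \<in> \<U>. x \<in> U}"
            "\<And>W. (W, U) \<in> r - Id \<Longrightarrow> W \<notin> {U \<in> \<U>. x \<in> U}"
          by (rule wfE_min) (rule that)
        obtain T where T: "open T" "U = A \<inter> T"
          using \<U>[of U] U(1) by (auto simp: openin_open)
        then obtain \<epsilon> where \<epsilon>: "\<epsilon> > 0" "ball x \<epsilon> \<subseteq> T"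
          using U(1) open_contains_ball by blast
        obtain n where n: "\<delta> n < \<epsilon>"
          using reals_Archimedean[OF \<epsilon>(1)] by (auto simp: \<delta>_def)
        have "x \<in> C n U"
          unfolding C_def
        proof (intro CollectI conjI ballI impI)
          show "y \<in> U" if "y \<in> A" "dist x y < \<delta> n" for y
            using that n \<epsilon>(2) T(2) by (auto simp: subset_iff)
          show "x \<notin> W" if "W \<in> \<U>" "(W, U) \<in> r \<and> W \<noteq> U" for W
            using that U(2)[of W] by blast
        qed (rule x)
        then have "x \<in> E n U"
          using x \<delta>[of n] by (auto simp: E_def intro!: bexI[of _ x])
        then show "x \<in> (\<Union>n. \<Union>U\<in>\<U>. E n U)"
          using U(1) by blast
      qed
    qed (auto simp: E_def)
    show "dist x y \<ge> \<delta> n / 3" if U: "U \<in> \<U>" "U' \<in> \<U>" "U \<noteq> U'" and xy: "x \<in> E n U" "y \<in> E n U'" for n U U' x y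
    proof -
      obtain x' y' where x': "x' \<in> C n U" "dist x' x < \<delta> n / 3" and y': "y' \<in> C n U'" "dist y' y < \<delta> n / 3"
        using xy by (auto simp: E_def)
      have "dist x' y' \<ge> \<delta> n"
        using tot[OF U] gap[of U U' x' n y'] gap[of U' U y' n x'] U x' y' by (auto simp: dist_commute)
      moreover have "dist x' y' \<le> dist x' x + dist x y + dist y y'"
        using dist_triangle[of x' y' x] dist_triangle[of x y' y] by linarith
      ultimately show ?thesis
        using x' y' by (simp add: dist_commute[of y y'])
    qed
  qed
qed

text \<open>Each discrete level of Stone's refinement is united to one set \<open>V n\<close>, which
  reduces the claim to a countable cover. The shrunken level \<open>T n\<close> is then cut back
  into the pieces \<open>T n \<inter> E n U\<close>. Pieces of one level are disjoint, so a point
  lies in at most one piece per level and the order stays the same.\<close>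

lemma covering_dim_le_open_refinement:
  fixes A :: "'a::metric_space set"
  assumes dim: "covering_dim_le (top_of_set A) (int d - 1)"
    and \<U>: "\<And>U. U \<in> \<U> \<Longrightarrow> openin (top_of_set A) U" and cover: "\<Union>\<U> = A"
  obtains \<W> where "\<And>W. W \<in> \<W> \<Longrightarrow> openin (top_of_set A) W" "\<And>W. W \<in> \<W> \<Longrightarrow> \<exists>U\<in>\<U>. W \<subseteq> U"
    "\<Union>\<W> = A" "locally_finite_in (top_of_set A) \<W>" "\<And>x. card {W \<in> \<W>. x \<in> W} \<le> d"
proof -
  obtain E e where E: "\<And>n U. openin (top_of_set A) (E n U)" "\<And>n U. U \<in> \<U> \<Longrightarrow> E n U \<subseteq> U"
    "(\<Union>n. \<Union>U\<in>\<U>. E n U) = A" and e: "\<And>n::nat. e n > 0"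
    and gap: "\<And>n U U' x y. U \<in> \<U> \<Longrightarrow> U' \<in> \<U> \<Longrightarrow> U \<noteq> U' \<Longrightarrow> x \<in> E n U \<Longrightarrow> y \<in> E n U' \<Longrightarrow> dist x y \<ge> (e n :: real)"
    by (rule sigma_discrete_refinement[OF \<U> cover]) (assumption, rule that)
  have disj: "U = U'" if "U \<in> \<U>" "U' \<in> \<U>" "x \<in> E n U" "x \<in> E n U'" for n U U' x
    using gap[of U U' x n x] that e[of n] by force
  define V where "V n = (\<Union>U\<in>\<U>. E n U)" for n
  have V_open: "openin (top_of_set A) (V n)" for n
    unfolding V_def using E(1) by (intro openin_Union) auto
  have V_cover: "(\<Union>n. V n) = A"
    using E(3) by (simp add: V_def)
  obtain T where T: "\<And>j. openin (top_of_set A) (T j)" "\<And>j. T j \<subseteq> V j" "(\<Union>j. T j) = A"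
    "\<And>x. x \<in> A \<Longrightarrow> \<exists>N. openin (top_of_set A) N \<and> x \<in> N \<and> finite {j. T j \<inter> N \<noteq> {}}"
    "\<And>x. x \<in> A \<Longrightarrow> finite {j. x \<in> T j} \<and> int (card {j. x \<in> T j}) \<le> int d - 1 + 1"
    by (rule covering_dim_le_countable_cover[OF dim V_open V_cover]) (rule that)
  define f where "f = (\<lambda>(n, U). T n \<inter> E n U)"
  define \<W> where "\<W> = f ` (UNIV \<times> \<U>)"
  show thesis
  proof (rule that[of \<W>])
    show "openin (top_of_set A) W" if "W \<in> \<W>" for W
      using that T(1) E(1) by (auto simp: \<W>_def f_def)
    show "\<exists>U\<in>\<U>. W \<subseteq> U" if W: "W \<in> \<W>" for W
    proof -
      obtain n U where nU: "U \<in> \<U>" "W = T n \<inter> E n U"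
        using W by (auto simp: \<W>_def f_def)
      then show ?thesis
        using E(2)[of U n] by blast
    qed
    show UN: "\<Union>\<W> = A"
    proof
      show "\<Union>\<W> \<subseteq> A"
        using T(3) by (auto simp: \<W>_def f_def)
      show "A \<subseteq> \<Union>\<W>"
      proof
        fix x assume "x \<in> A"
        then obtain n where n: "x \<in> T n" using T(3) by blast
        then obtain U where "U \<in> \<U>" "x \<in> E n U" using T(2)[of n] by (auto simp: V_def)
        then have "x \<in> f (n, U)" "f (n, U) \<in> \<W>"
          using n by (auto simp: f_def \<W>_def)
        then show "x \<in> \<Union>\<W>" by blast
      qed
    qed
    show "card {W \<in> \<W>. x \<in> W} \<le> d" for x
    proof (cases "x \<in> A")
      case True
      define h where "h n = f (n, SOME U. U \<in> \<U> \<and> x \<in> E n U)" for n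
      have "{W \<in> \<W>. x \<in> W} \<subseteq> h ` {n. x \<in> T n}"
      proof
        fix W assume "W \<in> {W \<in> \<W>. x \<in> W}"
        then obtain n U where nU: "U \<in> \<U>" "W = f (n, U)" "x \<in> T n" "x \<in> E n U"
          by (auto simp: \<W>_def f_def)
        then have "(SOME U. U \<in> \<U> \<and> x \<in> E n U) = U"
          using disj by (intro some_equality) auto
        then show "W \<in> h ` {n. x \<in> T n}"
          using nU by (auto simp: h_def)
      qed
      then have "card {W \<in> \<W>. x \<in> W} \<le> card {n. x \<in> T n}"
        using T(5)[OF True] by (intro surj_card_le) auto
      then show ?thesis
        using T(5)[OF True] by linarith
    next
      case False
      then have "{W \<in> \<W>. x \<in> W} = {}"
        using UN by blast
      then show ?thesis by (metis card.empty zero_le)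
    qed
    show "locally_finite_in (top_of_set A) \<W>"
      unfolding locally_finite_in_def
    proof (intro conjI ballI)
      show "\<Union>\<W> \<subseteq> topspace (top_of_set A)"
        using UN by simp
      fix x assume "x \<in> topspace (top_of_set A)"
      then have x: "x \<in> A" by simp
      obtain N where N: "openin (top_of_set A) N" "x \<in> N" and fin: "finite {j. T j \<inter> N \<noteq> {}}"
        using T(4)[OF x] by blast
      define J where "J = {j. T j \<inter> N \<noteq> {}}"
      \<comment> \<open>Only finitely many levels reach \<open>N\<close>. For each of them two
        points of the ball of radius \<open>e j / 2\<close> are closer than the gap
        \<open>e j\<close>, so \<open>B\<close> meets one piece at most.\<close>
      define B where "B = N \<inter> (\<Inter>j\<in>J. ball x (e j / 2))"
      have "openin (top_of_set A) B"
      proof (cases "J = {}")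
        case False
        have "open (\<Inter>j\<in>J. ball x (e j / 2))"
          using fin by (auto simp: J_def)
        then show ?thesis
          using N(1) unfolding B_def by (metis openin_Int_open)
      qed (use N in \<open>simp add: B_def\<close>)
      moreover have "x \<in> B"
        using N e by (auto simp: B_def)
      moreover have "finite {W \<in> \<W>. W \<inter> B \<noteq> {}}"
      proof -
        define h where "h j = f (j, SOME U. U \<in> \<U> \<and> E j U \<inter> B \<noteq> {})" for j
        have "{W \<in> \<W>. W \<inter> B \<noteq> {}} \<subseteq> h ` J"
        proof
          fix W assume "W \<in> {W \<in> \<W>. W \<inter> B \<noteq> {}}"
          then obtain j U where jU: "U \<in> \<U>" "W = f (j, U)" "T j \<inter> E j U \<inter> B \<noteq> {}"
            by (auto simp: \<W>_def f_def)
          then have j: "j \<in> J"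
            by (auto simp: J_def B_def)
          have "U' = U" if U': "U' \<in> \<U> \<and> E j U' \<inter> B \<noteq> {}" for U'
          proof (rule ccontr)
            assume "U' \<noteq> U"
            obtain y z where yz: "y \<in> E j U'" "y \<in> B" "z \<in> E j U" "z \<in> B"
              using U' jU by blast
            then have "dist x y < e j / 2" "dist x z < e j / 2"
              using j by (auto simp: B_def)
            then have "dist y z < e j"
              using dist_triangle[of y z x] by (simp add: dist_commute)
            then show False
              using gap[of U' U y j z] \<open>U' \<noteq> U\<close> U' jU yz by auto
          qed
          then have "(SOME U. U \<in> \<U> \<and> E j U \<inter> B \<noteq> {}) = U"
            using jU by (intro some_equality) blast+
          then show "W \<in> h ` J"
            using j jU by (auto simp: h_def)
        qed
        moreover have "finite J"
          using fin by (simp add: J_def)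
        ultimately show ?thesis
          by (meson finite_imageI finite_subset)
      qed
      ultimately show "\<exists>B. openin (top_of_set A) B \<and> x \<in> B \<and> finite {W \<in> \<W>. W \<inter> B \<noteq> {}}"
        by blast
    qed
  qed
qed

text \<open>The set \<phi> W consists of the points where \<open>g W\<close> is at least half of
  every other function \<open>g W'\<close>. Some of these functions is positive, whence \<phi> W
  lies in \<open>W\<close>. The factor 2 leaves room: if \<open>g W1\<close> is largest at
  \<open>x\<close>, then \<open>g W < 2 * g W1\<close> persists nearby, so even the interiors of the
  closed sets cover \<open>A\<close>. They form the open cover from which a tower is
  continued.\<close>

lemma covering_dim_le_closed_refinement:
  fixes A :: "'a::metric_space set"
  assumes dim: "covering_dim_le (top_of_set A) (int d - 1)"
    and \<U>: "\<And>U. U \<in> \<U> \<Longrightarrow> openin (top_of_set A) U" and cover: "\<Union>\<U> = A"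
  obtains \<F> where "\<And>F. F \<in> \<F> \<Longrightarrow> closedin (top_of_set A) F" "\<And>F. F \<in> \<F> \<Longrightarrow> \<exists>U\<in>\<U>. F \<subseteq> U"
    "\<Union>\<F> = A" "locally_finite_in (top_of_set A) \<F>" "\<And>x. card {F \<in> \<F>. x \<in> F} \<le> d"
    "(\<Union>F\<in>\<F>. top_of_set A interior_of F) = A"
proof -
  let ?X = "top_of_set A"
  obtain \<W> where W: "\<And>W. W \<in> \<W> \<Longrightarrow> openin ?X W" "\<And>W. W \<in> \<W> \<Longrightarrow> \<exists>U\<in>\<U>. W \<subseteq> U"
    "\<Union>\<W> = A" "locally_finite_in ?X \<W>" "\<And>x. card {W \<in> \<W>. x \<in> W} \<le> d"
    by (rule covering_dim_le_open_refinement[OF dim \<U> cover]) (assumption, rule that)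
  define g where "g W x = (if A \<subseteq> W then 1 else infdist x (A - W))" for W x
  have g_pos: "g W x > 0 \<longleftrightarrow> x \<in> W" if "x \<in> A" "W \<in> \<W>" for W x
    using infdist_complement_pos_iff[OF W(1)] that by (simp add: g_def)
  have g_nonneg: "g W x \<ge> 0" for W x
    by (simp add: g_def infdist_nonneg)
  have g_cont: "continuous_on A (g W)" for W
    unfolding g_def by (cases "A \<subseteq> W") (auto intro!: continuous_intros)
  define \<phi> where "\<phi> W = {x \<in> A. \<forall>W'\<in>\<W>. g W' x \<le> 2 * g W x}" for W
  have \<phi>W: "\<phi> W \<subseteq> W" if "W \<in> \<W>" for W
  proof
    fix x assume "x \<in> \<phi> W"
    then have x: "x \<in> A" "\<forall>W'\<in>\<W>. g W' x \<le> 2 * g W x"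
      by (auto simp: \<phi>_def)
    obtain W' where "W' \<in> \<W>" "x \<in> W'"
      using x W(3) by blast
    then have "g W x > 0"
      using g_pos[of x W'] x by fastforce
    then show "x \<in> W" using g_pos[OF x(1) that] by blast
  qed
  have \<phi>_closed: "closedin ?X (\<phi> W)" if "W \<in> \<W>" for W
  proof -
    have "\<phi> W = (\<Inter>W'\<in>\<W>. {x \<in> A. g W' x \<le> 2 * g W x})"
      using that by (auto simp: \<phi>_def)
    moreover have "closedin ?X {x \<in> A. g W' x \<le> 2 * g W x}" for W'
    proof -
      have "continuous_on A (\<lambda>x. g W' x - 2 * g W x)"
        by (intro continuous_intros g_cont)
      from continuous_closedin_preimage[OF this, of "{..0}"] show ?thesis
        by (simp add: vimage_def Int_def)
    qed
    ultimately show ?thesis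
      using that by (auto intro: closedin_Inter)
  qed
  have \<phi>_int: "\<exists>W\<in>\<W>. x \<in> ?X interior_of (\<phi> W)" if x: "x \<in> A" for x
  proof -
    obtain N where N: "openin ?X N" "x \<in> N" and fin: "finite {W \<in> \<W>. W \<inter> N \<noteq> {}}"
      using W(4) x unfolding locally_finite_in_def by auto
    define S where "S = {W \<in> \<W>. W \<inter> N \<noteq> {}}"
    obtain W0 where W0: "W0 \<in> \<W>" "x \<in> W0"
      using x W(3) by blast
    then have "W0 \<in> S" using N by (auto simp: S_def)
    have "finite ((\<lambda>W. g W x) ` S)" "(\<lambda>W. g W x) ` S \<noteq> {}"
      using fin \<open>W0 \<in> S\<close> by (auto simp: S_def)
    note Max = Max_in[OF this] Max_ge[OF this(1)]
    then obtain W1 where "W1 \<in> S" "g W1 x = Max ((\<lambda>W. g W x) ` S)"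
      by force
    then have W1: "W1 \<in> S" "\<And>W. W \<in> S \<Longrightarrow> g W x \<le> g W1 x"
      using Max(2) by auto
    have pos: "g W1 x > 0"
      using W1(2)[OF \<open>W0 \<in> S\<close>] g_pos[OF x W0(1)] W0 by linarith
    \<comment> \<open>Finitely many strict inequalities suffice, because all members outside
      \<open>S\<close> miss \<open>N\<close>, and their functions vanish there.\<close>
    define O' where "O' = N \<inter> (\<Inter>W\<in>S. {y \<in> A. g W y - 2 * g W1 y < 0})"
    have "openin ?X {y \<in> A. g W y - 2 * g W1 y < 0}" for W
    proof -
      have "continuous_on A (\<lambda>y. g W y - 2 * g W1 y)"
        by (intro continuous_intros g_cont)
      from continuous_openin_preimage_gen[OF this, of "{..<0}"] show ?thesis
        by (simp add: vimage_def Int_def)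
    qed
    then have "openin ?X O'"
      unfolding O'_def using N fin \<open>W0 \<in> S\<close> by (intro openin_Int openin_Inter) (auto simp: S_def)
    moreover have "x \<in> O'"
    proof -
      have "g W x - 2 * g W1 x < 0" if "W \<in> S" for W
        using W1(2)[OF that] pos by linarith
      then show ?thesis
        using N x by (auto simp: O'_def)
    qed
    moreover have "O' \<subseteq> \<phi> W1"
    proof
      fix y assume y: "y \<in> O'"
      have yA: "y \<in> A" using y \<open>W0 \<in> S\<close> by (auto simp: O'_def)
      have "g W y \<le> 2 * g W1 y" if "W \<in> \<W>" for W
      proof (cases "W \<in> S")
        case True
        then show ?thesis using y by (force simp: O'_def)
      next
        case False
        then have "y \<notin> W" using y that by (auto simp: O'_def S_def)
        then have "g W y \<le> 0" using g_pos[OF yA that] by linarith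
        then show ?thesis using g_nonneg[of W1 y] by linarith
      qed
      then show "y \<in> \<phi> W1"
        using yA by (simp add: \<phi>_def)
    qed
    ultimately have "x \<in> ?X interior_of (\<phi> W1)"
      unfolding interior_of_def by blast
    then show ?thesis
      using W1(1) by (auto simp: S_def)
  qed
  show thesis
  proof (rule that[of "\<phi> ` \<W>"])
    show "closedin ?X F" if "F \<in> \<phi> ` \<W>" for F
      using that \<phi>_closed by blast
    show "\<exists>U\<in>\<U>. F \<subseteq> U" if F: "F \<in> \<phi> ` \<W>" for F
    proof -
      obtain W where "W \<in> \<W>" "F = \<phi> W"
        using F by blast
      then show ?thesis
        using \<phi>W[of W] W(2)[of W] by auto
    qed
    have int_sub: "?X interior_of (\<phi> W) \<subseteq> \<phi> W" for W
      by (rule interior_of_subset)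
    show UN: "\<Union>(\<phi> ` \<W>) = A"
    proof
      show "A \<subseteq> \<Union>(\<phi> ` \<W>)"
      proof
        fix x assume "x \<in> A"
        then obtain W where "W \<in> \<W>" "x \<in> ?X interior_of (\<phi> W)"
          using \<phi>_int by blast
        then show "x \<in> \<Union>(\<phi> ` \<W>)"
          using int_sub[of W] by blast
      qed
    qed (auto simp: \<phi>_def)
    show "(\<Union>F\<in>\<phi> ` \<W>. ?X interior_of F) = A"
    proof
      show "A \<subseteq> (\<Union>F\<in>\<phi> ` \<W>. ?X interior_of F)"
        using \<phi>_int by blast
      show "(\<Union>F\<in>\<phi> ` \<W>. ?X interior_of F) \<subseteq> A"
      proof (rule UN_least)
        fix F assume "F \<in> \<phi> ` \<W>"
        then have "F \<subseteq> A" using UN by blast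
        then show "?X interior_of F \<subseteq> A"
          using interior_of_subset[of ?X F] by blast
      qed
    qed
    show "locally_finite_in ?X (\<phi> ` \<W>)"
      by (rule locally_finite_in_refinement[OF W(4) \<phi>W])
    show "card {F \<in> \<phi> ` \<W>. x \<in> F} \<le> d" for x
    proof (cases "x \<in> A")
      case True
      have "{F \<in> \<phi> ` \<W>. x \<in> F} \<subseteq> \<phi> ` {W \<in> \<W>. x \<in> W}"
        using \<phi>W by auto
      moreover have "finite {W \<in> \<W>. x \<in> W}"
        using locally_finite_in_finite_members[OF W(4)] True by simp
      ultimately have "card {F \<in> \<phi> ` \<W>. x \<in> F} \<le> card {W \<in> \<W>. x \<in> W}"
        by (intro surj_card_le)
      then show ?thesis using W(5)[of x] by linarith
    next
      case False
      then have "{F \<in> \<phi> ` \<W>. x \<in> F} = {}"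
        using UN by blast
      then show ?thesis by (metis card.empty zero_le)
    qed
  qed
qed

lemma locally_finite_in_closed_subspace:
  assumes "locally_finite_in (subtopology X A) \<F>" "closedin X A"
  shows "locally_finite_in X \<F>"
  unfolding locally_finite_in_def
proof (intro conjI ballI)
  have AX: "A \<subseteq> topspace X"
    using assms(2) closedin_subset by auto
  have UA: "\<Union>\<F> \<subseteq> A"
    using assms(1) unfolding locally_finite_in_def by simp
  then show "\<Union>\<F> \<subseteq> topspace X"
    using AX by blast
  fix x assume x: "x \<in> topspace X"
  show "\<exists>V. openin X V \<and> x \<in> V \<and> finite {U \<in> \<F>. U \<inter> V \<noteq> {}}"
  proof (cases "x \<in> A")
    case True
    then have "x \<in> topspace (subtopology X A)"
      using x by simp
    then obtain V where V: "openin (subtopology X A) V" "x \<in> V" "finite {U \<in> \<F>. U \<inter> V \<noteq> {}}"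
      using assms(1) unfolding locally_finite_in_def by meson
    then obtain T where T: "openin X T" "V = T \<inter> A"
      by (auto simp: openin_subtopology)
    have "{U \<in> \<F>. U \<inter> T \<noteq> {}} = {U \<in> \<F>. U \<inter> V \<noteq> {}}"
      using UA T(2) by blast
    then show ?thesis
      using T V by (intro exI[of _ T]) auto
  next
    case False
    have "{U \<in> \<F>. U \<inter> (topspace X - A) \<noteq> {}} = {}"
      using UA by blast
    then have "finite {U \<in> \<F>. U \<inter> (topspace X - A) \<noteq> {}}"
      by (simp only: finite.emptyI)
    then show ?thesis
      using False x assms(2) by (intro exI[of _ "topspace X - A"] conjI) auto
  qed
qed

text \<open>Each stage refines the interiors of the previous closed cover, cut down by small balls;
  this yields nesting and mesh together. Closedness and local finiteness hold relative to
  \<open>A\<close> and pass to the whole space since \<open>A\<close> is closed.\<close>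

lemma covering_dim_le_imp_cover_tower:
  fixes A :: "'a::metric_space set"
  assumes A: "closed A" and dim: "covering_dim_le (top_of_set A) (int d - 1)"
  shows "cover_tower d A"
proof -
  let ?X = "top_of_set A"
  define P where "P = (\<lambda>(i::nat) \<F>. (\<forall>F\<in>\<F>. closedin ?X F) \<and> \<Union>\<F> = A \<and> locally_finite_in ?X \<F> \<and>
     (\<forall>F\<in>\<F>. \<forall>x\<in>F. \<forall>y\<in>F. dist x y < inverse (Suc i)) \<and>
     (\<forall>x. card {F \<in> \<F>. x \<in> F} \<le> d) \<and> (\<Union>F\<in>\<F>. ?X interior_of F) = A)"
  define Q where "Q = (\<lambda>(i::nat) \<F> \<G>. \<forall>G\<in>\<G>. \<exists>F\<in>(\<F>::'a set set). G \<subseteq> F)"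
  have step: "\<exists>\<G>. P i \<G> \<and> (\<forall>G\<in>\<G>. \<exists>H\<in>\<H>. G \<subseteq> H)"
    if \<H>: "\<And>H. H \<in> \<H> \<Longrightarrow> openin ?X H" "\<Union>\<H> = A" for i \<H>
  proof -
    define r where "r = inverse (real (Suc i)) / 2"
    have r: "r > 0" by (simp add: r_def)
    define \<U> where "\<U> = (\<lambda>(H, x). H \<inter> ball x r) ` (\<H> \<times> A)"
    have 1: "openin ?X U" if "U \<in> \<U>" for U
      using that \<H>(1) by (auto simp: \<U>_def intro: openin_Int_open)
    have 2: "\<Union>\<U> = A"
    proof
      show "A \<subseteq> \<Union>\<U>"
      proof
        fix x assume x: "x \<in> A"
        then obtain H where "H \<in> \<H>" "x \<in> H" using \<H>(2) by blast
        then have "H \<inter> ball x r \<in> \<U>" "x \<in> H \<inter> ball x r"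
          using x r by (auto simp: \<U>_def)
        then show "x \<in> \<Union>\<U>" by blast
      qed
    qed (use \<H>(2) in \<open>auto simp: \<U>_def\<close>)
    obtain \<F> where F: "\<And>F. F \<in> \<F> \<Longrightarrow> closedin ?X F" "\<And>F. F \<in> \<F> \<Longrightarrow> \<exists>U\<in>\<U>. F \<subseteq> U"
      "\<Union>\<F> = A" "locally_finite_in ?X \<F>" "\<And>x. card {F \<in> \<F>. x \<in> F} \<le> d"
      "(\<Union>F\<in>\<F>. ?X interior_of F) = A"
      by (rule covering_dim_le_closed_refinement[OF dim 1 2]) (assumption, rule that)
    have mesh: "dist x y < inverse (Suc i)" if xy: "F \<in> \<F>" "x \<in> F" "y \<in> F" for F x y
    proof -
      obtain U where U: "U \<in> \<U>" "F \<subseteq> U" using F(2)[OF xy(1)] by blast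
      then obtain z where "U \<subseteq> ball z r"
        by (auto simp: \<U>_def)
      then have "dist z x < r" "dist z y < r"
        using U xy by auto
      then have "dist x y < 2 * r"
        using dist_triangle[of x y z] by (simp add: dist_commute)
      then show ?thesis by (simp add: r_def)
    qed
    have ref: "\<exists>H\<in>\<H>. F \<subseteq> H" if xy: "F \<in> \<F>" for F
    proof -
      obtain U where U: "U \<in> \<U>" "F \<subseteq> U" using F(2)[OF xy(1)] by blast
      then obtain H where "H \<in> \<H>" "U \<subseteq> H"
        by (auto simp: \<U>_def)
      then show ?thesis using U by blast
    qed
    have "P i \<F>"
      unfolding P_def using F(1,3-6) mesh by (intro conjI ballI allI)
    then show ?thesis
      using ref by blast
  qed
  have "\<exists>f. \<forall>i. P i (f i) \<and> Q i (f i) (f (Suc i))"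
  proof (rule dependent_nat_choice)
    show "\<exists>\<F>. P 0 \<F>"
      using step[of "{A}" 0] by auto
    fix \<F> i assume "P i \<F>"
    then have "(\<Union>F\<in>\<F>. ?X interior_of F) = A"
      by (simp add: P_def)
    moreover have "openin ?X H" if "H \<in> (\<lambda>F. ?X interior_of F) ` \<F>" for H
      using that by auto
    ultimately obtain \<G> where \<G>: "P (Suc i) \<G>" "\<forall>G\<in>\<G>. \<exists>H\<in>(\<lambda>F. ?X interior_of F) ` \<F>. G \<subseteq> H"
      using step[of "(\<lambda>F. ?X interior_of F) ` \<F>" "Suc i"] by blast
    have "\<exists>F\<in>\<F>. G \<subseteq> F" if G: "G \<in> \<G>" for G
    proof -
      obtain F where "F \<in> \<F>" "G \<subseteq> ?X interior_of F"
        using \<G>(2) G by auto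
      then show ?thesis
        using interior_of_subset[of ?X F] by blast
    qed
    then show "\<exists>\<G>. P (Suc i) \<G> \<and> Q i \<F> \<G>"
      using \<G>(1) by (auto simp: Q_def)
  qed
  then obtain f where f: "\<And>i. P i (f i)" "\<And>i. Q i (f i) (f (Suc i))"
    by blast
  show ?thesis
    unfolding cover_tower_def
  proof (intro exI[of _ f] allI conjI)
    fix i
    have fi: "\<And>F. F \<in> f i \<Longrightarrow> closedin ?X F" "\<Union>(f i) = A" "locally_finite_in ?X (f i)"
      "\<forall>F\<in>f i. \<forall>x\<in>F. \<forall>y\<in>F. dist x y < inverse (Suc i)" "\<And>x. card {F \<in> f i. x \<in> F} \<le> d"
      using f(1)[of i] by (simp_all add: P_def)
    show "locally_finite_in euclidean (f i)"
      using locally_finite_in_closed_subspace[OF fi(3)] A by simp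
    show "\<forall>C\<in>f i. closed C"
      using fi(1) A closedin_closed_trans by blast
    show "\<Union>(f i) = A" by fact
    show "\<forall>C\<in>f i. \<forall>x\<in>C. \<forall>y\<in>C. dist x y < inverse (Suc i)" by fact
    show "card {C \<in> f i. x \<in> C} \<le> d" for x by fact
    show "\<forall>C\<in>f (Suc i). \<exists>C'\<in>f i. C \<subseteq> C'"
      using f(2)[of i] by (simp add: Q_def)
  qed
qed

section \<open>Paths in locally connected complete spaces\<close>

lemma locally_connected_small_neighbourhood:
  fixes W :: "'a::metric_space set"
  assumes "locally connected (UNIV :: 'a set)" "open W" "x \<in> W" "\<epsilon> > 0"
  obtains V where "open V" "connected V" "x \<in> V" "closure V \<subseteq> W" "\<And>y z. y \<in> V \<Longrightarrow> z \<in> V \<Longrightarrow> dist y z < \<epsilon>"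
proof -
  obtain r where r: "r > 0" "cball x r \<subseteq> W"
    using assms open_contains_cball by blast
  define s where "s = min r (\<epsilon> / 2)"
  have s: "s > 0" "s \<le> r" "s \<le> \<epsilon> / 2"
    using r assms by (auto simp: s_def)
  obtain V where V: "open V" "connected V" "x \<in> V" "V \<subseteq> ball x s"
    using assms(1) s(1) unfolding locally_connected by (metis centre_in_ball open_ball open_openin subtopology_UNIV)
  show thesis
  proof (rule that[OF V(1-3)])
    have "closure V \<subseteq> cball x s"
      using V(4) by (meson ball_subset_cball closed_cball closure_minimal order_trans)
    then show "closure V \<subseteq> W"
      using r s by (meson cball_subset_cball_iff order_trans subset_cball)
    show "dist y z < \<epsilon>" if "y \<in> V" "z \<in> V" for y z
    proof -
      have "dist x y < s" "dist x z < s"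
        using V(4) that by auto
      then show ?thesis
        using dist_triangle[of y z x] s(3) by (simp add: dist_commute)
    qed
  qed
qed

text \<open>If \<open>b\<close> were not reachable, small sets with a reachable point outside
  \<open>M\<close> and those with an unreachable one would disconnect \<open>W\<close>: overlapping
  small sets share a point outside \<open>M\<close> by density. Joints outside \<open>M\<close>
  survive the removal of further closed parts of \<open>M\<close>. All large lengths occur since the
  link from \<open>b\<close> to itself may be repeated, which makes it possible to give several
  chains a common length.\<close>

lemma chain_of_small_connected_sets:
  fixes W M :: "'a::metric_space set"
  assumes lc: "locally connected (UNIV :: 'a set)" and W: "open W" "connected W" and "\<epsilon> > 0"
    and dense: "\<And>V. open V \<Longrightarrow> V \<noteq> {} \<Longrightarrow> V - M \<noteq> {}"
    and ab: "a \<in> W - M" "b \<in> W - M"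
  obtains n0 where "\<And>n::nat. n \<ge> n0 \<Longrightarrow> \<exists>q V. q 0 = a \<and> q n = b \<and> (\<forall>k<n. open (V k) \<and> connected (V k) \<and>
      q k \<in> V k - M \<and> q (Suc k) \<in> V k - M \<and> closure (V k) \<subseteq> W \<and> (\<forall>y\<in>V k. \<forall>z\<in>V k. dist y z < \<epsilon>))"
proof -
  define S where "S = {V. open V \<and> connected V \<and> closure V \<subseteq> W \<and> (\<forall>y\<in>V. \<forall>z\<in>V. dist y z < \<epsilon>)}"
  define R where "R = (\<lambda>c d. \<exists>V\<in>S. c \<in> V - M \<and> d \<in> V - M)"
  have S_ex: "\<exists>V\<in>S. x \<in> V" if x: "x \<in> W" for x
  proof -
    obtain V where "open V" "connected V" "x \<in> V" "closure V \<subseteq> W" "\<And>y z. y \<in> V \<Longrightarrow> z \<in> V \<Longrightarrow> dist y z < \<epsilon>"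
      by (rule locally_connected_small_neighbourhood[OF lc W(1) x \<open>\<epsilon> > 0\<close>]) (rule that)
    then show ?thesis by (auto simp: S_def)
  qed
  have SW: "V \<subseteq> W" "open V" if "V \<in> S" for V
    using that closure_subset[of V] by (auto simp: S_def)
  have refl: "R c c" if "c \<in> W - M" for c
    using S_ex[of c] that by (auto simp: R_def)
  have conn: "R\<^sup>*\<^sup>* a b"
  proof (rule ccontr)
    assume nab: "\<not> R\<^sup>*\<^sup>* a b"
    define O1 where "O1 = \<Union>{V \<in> S. \<exists>c\<in>V - M. R\<^sup>*\<^sup>* a c}"
    define O2 where "O2 = \<Union>{V \<in> S. \<exists>c\<in>V - M. \<not> R\<^sup>*\<^sup>* a c}"
    have "open O1" "open O2"
      unfolding O1_def O2_def using SW by auto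
    moreover have "O1 \<inter> O2 = {}"
    proof (rule ccontr)
      assume "O1 \<inter> O2 \<noteq> {}"
      then obtain V1 V2 c1 c2 where V: "V1 \<in> S" "V2 \<in> S" "V1 \<inter> V2 \<noteq> {}" "c1 \<in> V1 - M" "R\<^sup>*\<^sup>* a c1"
          "c2 \<in> V2 - M" "\<not> R\<^sup>*\<^sup>* a c2"
        unfolding O1_def O2_def by blast
      then obtain c where c: "c \<in> V1 \<inter> V2 - M"
        using dense[of "V1 \<inter> V2"] SW(2) by blast
      have "R c1 c" "R c c2"
        using V c unfolding R_def by blast+
      then show False
        using V by (meson rtranclp.rtrancl_into_rtrancl)
    qed
    moreover have "W \<subseteq> O1 \<union> O2"
    proof
      fix x assume "x \<in> W"
      then obtain V where V: "V \<in> S" "x \<in> V" using S_ex by blast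
      then obtain c where "c \<in> V - M"
        using dense[of V] SW by blast
      then show "x \<in> O1 \<union> O2"
        using V unfolding O1_def O2_def by blast
    qed
    moreover have "a \<in> O1"
      using S_ex[of a] ab unfolding O1_def by blast
    moreover have "b \<in> O2"
      using S_ex[of b] ab nab unfolding O2_def by blast
    ultimately show False
      using W(2) ab unfolding connected_def by blast
  qed
  then obtain n0 where n0: "(R ^^ n0) a b"
    by (auto simp: rtranclp_power)
  have reflpow: "(R ^^ k) b b" for k
    by (induction k) (use refl ab in auto)
  show thesis
  proof (rule that[of n0])
    fix n assume "n \<ge> n0"
    then obtain k where "n = n0 + k"
      using le_Suc_ex by blast
    then have "(R ^^ n) a b"
      using n0 reflpow[of k] by (auto simp: relpowp_add)
    then obtain q where q: "q 0 = a" "q n = b" "\<And>k. k < n \<Longrightarrow> R (q k) (q (Suc k))"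
      by (auto simp: relpowp_fun_conv)
    define V where "V k = (SOME V. V \<in> S \<and> q k \<in> V - M \<and> q (Suc k) \<in> V - M)" for k
    have V: "V k \<in> S \<and> q k \<in> V k - M \<and> q (Suc k) \<in> V k - M" if "k < n" for k
      unfolding V_def by (rule someI_ex) (use q(3)[OF that] in \<open>auto simp: R_def\<close>)
    show "\<exists>q V. q 0 = a \<and> q n = b \<and> (\<forall>k<n. open (V k) \<and> connected (V k) \<and>
      q k \<in> V k - M \<and> q (Suc k) \<in> V k - M \<and> closure (V k) \<subseteq> W \<and> (\<forall>y\<in>V k. \<forall>z\<in>V k. dist y z < \<epsilon>))"
    proof (intro exI conjI allI impI)
      show "q 0 = a" "q n = b" by fact+
      fix k assume "k < n"
      from V[OF this] have "V k \<in> S" "q k \<in> V k - M" "q (Suc k) \<in> V k - M"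
        by blast+
      then show "open (V k)" "connected (V k)" "q k \<in> V k - M" "q (Suc k) \<in> V k - M" "closure (V k) \<subseteq> W"
         "\<forall>y\<in>V k. \<forall>z\<in>V k. dist y z < \<epsilon>"
        by (simp_all add: S_def)
    qed
  qed
qed

text \<open>The index of the piece containing \<open>t\<close> when \<open>[0, 1]\<close> is cut into \<open>N\<close> equal pieces.\<close>

definition piece :: "nat \<Rightarrow> real \<Rightarrow> nat" where
  "piece N t = (if t < 1 then nat \<lfloor>t * N\<rfloor> else N - 1)"

lemma piece_less: "N \<ge> 1 \<Longrightarrow> 0 \<le> t \<Longrightarrow> piece N t < N"
proof -
  assume N: "N \<ge> 1" and t: "0 \<le> t"
  have "\<lfloor>t * N\<rfloor> < int N" if "t < 1"
    using that N by (simp add: floor_less_iff)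
  then show ?thesis
    using N t unfolding piece_def by auto
qed

text \<open>Piece \<open>k\<close> of the finer division lies in piece \<open>k div m\<close> of the
  coarser one. Subdividing all links by the same factor therefore makes the links belonging to a
  fixed \<open>t\<close> nested.\<close>

lemma piece_div:
  assumes "N \<ge> 1" "m \<ge> 1" "0 \<le> t"
  shows "piece (N * m) t div m = piece N t"
proof (cases "t < 1")
  case True
  have "\<lfloor>t * N\<rfloor> = \<lfloor>(t * real (N * m)) / real_of_int (int m)\<rfloor>"
    using assms by simp
  also have "\<dots> = \<lfloor>t * real (N * m)\<rfloor> div int m"
    by (rule floor_divide_real_eq_div) simp
  finally show ?thesis
    using True assms by (simp add: piece_def nat_div_distrib)
next
  case False
  have "(N * m - 1) div m = N - 1"
  proof (rule div_nat_eqI)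
    show "m * (N - 1) \<le> N * m - 1"
      using assms by (cases N) (auto simp: algebra_simps)
    show "N * m - 1 < m * Suc (N - 1)"
      using assms by (cases N) (auto simp: algebra_simps)
  qed
  then show ?thesis
    using False by (simp add: piece_def)
qed

text \<open>Continuity of the limit path rests on this: close parameters lie in equal or adjacent
  pieces, and adjacent links share a joint. The parameter 1 is counted to the last piece, so no
  extra link is needed at the end.\<close>

lemma piece_le_Suc:
  assumes "N \<ge> 1" "0 \<le> s" "s \<le> 1" "0 \<le> t" "t \<le> 1" "\<bar>s - t\<bar> < 1 / N"
  shows "piece N s \<le> Suc (piece N t)"
proof -
  have "\<bar>s - t\<bar> * N < 1"
    using assms by (simp add: field_simps)
  then have lt: "\<bar>s * N - t * N\<bar> < 1"
    using assms by (simp add: abs_mult flip: left_diff_distrib)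
  show ?thesis
  proof (cases "t < 1")
    case True
    have "s * N < \<lfloor>t * N\<rfloor> + 2"
      using lt by linarith
    then have fl: "\<lfloor>s * N\<rfloor> \<le> \<lfloor>t * N\<rfloor> + 1"
      by (simp add: floor_le_iff)
    have "\<lfloor>t * N\<rfloor> \<ge> 0"
      using assms by simp
    show ?thesis
    proof (cases "s < 1")
      case True
      then show ?thesis
        using \<open>t < 1\<close> fl \<open>\<lfloor>t * N\<rfloor> \<ge> 0\<close> unfolding piece_def by simp
    next
      case False
      then have "s = 1" using assms by simp
      then have "int N \<le> \<lfloor>t * N\<rfloor> + 1"
        using fl by simp
      then show ?thesis
        using \<open>t < 1\<close> False \<open>\<lfloor>t * N\<rfloor> \<ge> 0\<close> unfolding piece_def by simp
    qed
  next
    case False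
    then have "piece N t = N - 1" by (simp add: piece_def)
    then show ?thesis
      using piece_less[of N s] assms by simp
  qed
qed

text \<open>Every \<open>t\<close> determines a nested sequence of links with diameters tending to
  zero, so completeness gives a limit. The closure of a link at stage \<open>Suc i\<close> lies in
  its parent without \<open>F i\<close>; this keeps the limit in all links and outside every
  \<open>F i\<close>.\<close>

lemma path_avoiding_closed_sets:
  fixes F :: "nat \<Rightarrow> 'a::complete_space set"
  assumes lc: "locally connected (UNIV :: 'a set)" and F: "\<And>i. closed (F i)"
    and conn: "\<And>i V. open V \<Longrightarrow> connected V \<Longrightarrow> V \<noteq> {} \<Longrightarrow> connected (V - F i) \<and> V - F i \<noteq> {}"
    and U: "open U" "connected U" and xy: "x \<in> U - (\<Union>i. F i)" "y \<in> U - (\<Union>i. F i)"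
  shows "\<exists>g. path g \<and> path_image g \<subseteq> U - (\<Union>i. F i) \<and> pathstart g = x \<and> pathfinish g = y"
proof -
  define M where "M = (\<Union>i. F i)"
  \<comment> \<open>An \<open>F i\<close> with interior would contain a nonempty connected open set,
    against \<open>conn\<close>. Baire's theorem then gives \<open>M\<close> empty interior.\<close>
  have dense: "V - M \<noteq> {}" if V: "open V" "V \<noteq> {}" for V
  proof
    assume "V - M = {}"
    then have "V \<subseteq> interior M"
      using V by (simp add: interior_maximal)
    have "euclidean interior_of \<Union>(range F) = {}"
    proof (rule Baire_category_alt)
      show "completely_metrizable_space (euclidean :: 'a topology) \<or>
            locally_compact_space (euclidean :: 'a topology) \<and> regular_space (euclidean :: 'a topology)"
        by (simp add: completely_metrizable_space_euclidean)
      show "closedin euclidean T \<and> euclidean interior_of T = {}" if T: "T \<in> range F" for T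
      proof -
        obtain i where i: "T = F i" using T by blast
        have "interior (F i) = {}"
        proof (rule ccontr)
          assume "interior (F i) \<noteq> {}"
          then obtain z where z: "z \<in> interior (F i)" by blast
          obtain V where V: "open V" "connected V" "z \<in> V" "closure V \<subseteq> interior (F i)"
              "\<And>u v. u \<in> V \<Longrightarrow> v \<in> V \<Longrightarrow> dist u v < 1"
            by (rule locally_connected_small_neighbourhood[OF lc open_interior z zero_less_one]) (rule that)
          then have "V - F i = {}"
            using closure_subset[of V] interior_subset[of "F i"] by blast
          then show False
            using conn[OF V(1,2)] V(3) by blast
        qed
        then show ?thesis using F i by simp
      qed
    qed auto
    then show False
      using \<open>V \<subseteq> interior M\<close> V(2) by (simp add: M_def)
  qed
  define P where "P = (\<lambda>(i::nat) (N::nat, p::nat \<Rightarrow> 'a, V::nat \<Rightarrow> 'a set). N \<ge> 1 \<and> p 0 = x \<and> p N = y \<and>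
     (\<forall>j<N. open (V j) \<and> connected (V j) \<and> p j \<in> V j - M \<and> p (Suc j) \<in> V j - M \<and> V j \<subseteq> U))"
  define Q where "Q = (\<lambda>(i::nat) (N::nat, p::nat \<Rightarrow> 'a, V::nat \<Rightarrow> 'a set) (N', p'::nat \<Rightarrow> 'a, V'::nat \<Rightarrow> 'a set).
     \<exists>m\<ge>1. N' = N * m \<and> (\<forall>k<N'. closure (V' k) \<subseteq> V (k div m) - F i \<and>
        (\<forall>u\<in>V' k. \<forall>v\<in>V' k. dist u v < inverse (real (Suc i)))))"
  have "\<exists>f. \<forall>i. P i (f i) \<and> Q i (f i) (f (Suc i))"
  proof (rule dependent_nat_choice)
    have "P 0 (1, \<lambda>j. if j = 0 then x else y, \<lambda>_. U)"
      using U xy by (simp add: P_def M_def)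
    then show "\<exists>s. P 0 s" ..
    fix s i assume Ps: "P i s"
    obtain N p V where s: "s = (N, p, V)" by (metis prod_cases3)
    have N: "N \<ge> 1" "p 0 = x" "p N = y" and V: "\<And>j. j < N \<Longrightarrow> open (V j)" "\<And>j. j < N \<Longrightarrow> connected (V j)"
      "\<And>j. j < N \<Longrightarrow> p j \<in> V j - M" "\<And>j. j < N \<Longrightarrow> p (Suc j) \<in> V j - M" "\<And>j. j < N \<Longrightarrow> V j \<subseteq> U"
      using Ps unfolding s P_def by auto
    define C where "C = (\<lambda>j n q T. q 0 = p j \<and> q n = p (Suc j) \<and> (\<forall>k<n. open (T k) \<and> connected (T k) \<and>
      q k \<in> T k - M \<and> q (Suc k) \<in> T k - M \<and> closure (T k) \<subseteq> V j - F i \<and>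
      (\<forall>u\<in>T k. \<forall>v\<in>T k. dist u v < inverse (real (Suc i)))))"
    have "\<exists>n0. \<forall>n\<ge>n0. \<exists>q T. C j n q T" if j: "j < N" for j
    proof -
      have 1: "open (V j - F i)"
        using V(1)[OF j] F by (simp add: open_Diff)
      have 2: "connected (V j - F i)"
        using conn[OF V(1,2)[OF j]] V(3)[OF j] by blast
      have 3: "p j \<in> V j - F i - M" "p (Suc j) \<in> V j - F i - M"
        using V(3,4)[OF j] by (auto simp: M_def)
      have 4: "inverse (real (Suc i)) > 0" by simp
      obtain n0 where "\<And>n. n \<ge> n0 \<Longrightarrow> \<exists>q T. q 0 = p j \<and> q n = p (Suc j) \<and> (\<forall>k<n. open (T k) \<and> connected (T k) \<and>
      q k \<in> T k - M \<and> q (Suc k) \<in> T k - M \<and> closure (T k) \<subseteq> V j - F i \<and> (\<forall>y\<in>T k. \<forall>z\<in>T k. dist y z < inverse (real (Suc i))))"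
        by (rule chain_of_small_connected_sets[OF lc 1 2 4 dense 3]) (assumption, assumption, rule that)
      then show ?thesis
        unfolding C_def by blast
    qed
    then obtain n0 where n0: "\<And>j n. j < N \<Longrightarrow> n \<ge> n0 j \<Longrightarrow> \<exists>q T. C j n q T"
      by metis
    \<comment> \<open>One factor for all links: the required lengths differ, but every chain may be
      lengthened.\<close>
    define m where "m = Suc (\<Sum>j<N. n0 j)"
    have "n0 j \<le> m" if "j < N" for j
      using member_le_sum[of j "{..<N}" n0] that by (simp add: m_def)
    then have "\<exists>q T. C j m q T" if "j < N" for j
      using n0 that by blast
    then obtain q T where qT: "\<And>j. j < N \<Longrightarrow> C j m (q j) (T j)"
      by metis
    \<comment> \<open>The default \<open>y\<close> is for the index \<open>N * m\<close>, the end of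
      the last chain, whose quotient by \<open>m\<close> is no longer the index of a link.\<close>
    define p' where "p' k = (if k div m < N then q (k div m) (k mod m) else y)" for k
    define V' where "V' k = T (k div m) (k mod m)" for k
    have m: "m \<ge> 1" by (simp add: m_def)
    have jN: "k div m < N" "k mod m < m" if "k < N * m" for k
      using that m by (simp_all add: less_mult_imp_div_less)
    have p'_Suc: "p' (Suc k) = q (k div m) (Suc (k mod m))" if k: "k < N * m" for k
    proof (cases "Suc (k mod m) = m")
      case False
      then have "Suc k div m = k div m" "Suc k mod m = Suc (k mod m)"
        by (simp_all add: div_Suc mod_Suc)
      then show ?thesis
        using jN[OF k] by (simp add: p'_def)
    next
      case True
      then have *: "Suc k div m = Suc (k div m)" "Suc k mod m = 0"
        by (simp_all add: div_Suc mod_Suc)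
      have "q (k div m) m = p (Suc (k div m))"
        using qT[OF jN(1)[OF k]] by (simp add: C_def)
      moreover have "p' (Suc k) = p (Suc (k div m))"
      proof (cases "Suc (k div m) < N")
        case True
        then show ?thesis
          using qT[OF True] by (simp add: p'_def * C_def)
      next
        case False
        then have "Suc (k div m) = N" using jN[OF k] by simp
        then show ?thesis using N by (simp add: p'_def *)
      qed
      ultimately show ?thesis using True by simp
    qed
    have C': "open (V' k) \<and> connected (V' k) \<and> p' k \<in> V' k - M \<and> p' (Suc k) \<in> V' k - M \<and>
        closure (V' k) \<subseteq> V (k div m) - F i \<and> (\<forall>u\<in>V' k. \<forall>v\<in>V' k. dist u v < inverse (real (Suc i)))"
      if k: "k < N * m" for k
      using qT[OF jN(1)[OF k]] jN[OF k] unfolding p'_Suc[OF k] V'_def C_def by (simp add: p'_def)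
    have "P (Suc i) (N * m, p', V')"
    proof -
      have "N * m \<ge> 1" using N m by simp
      moreover have "p' 0 = x" using qT[of 0] N by (simp add: p'_def C_def)
      moreover have "p' (N * m) = y" using m by (simp add: p'_def)
      moreover have "V' k \<subseteq> U" if k: "k < N * m" for k
        using C'[OF k] closure_subset[of "V' k"] V(5)[OF jN(1)[OF k]] by blast
      ultimately show ?thesis
        using C' unfolding P_def by simp
    qed
    moreover have "Q i s (N * m, p', V')"
      unfolding Q_def s using m C' by auto
    ultimately show "\<exists>s'. P (Suc i) s' \<and> Q i s s'" by blast
  qed
  then obtain f where f: "\<And>i. P i (f i)" "\<And>i. Q i (f i) (f (Suc i))"
    by blast
  define N where "N i = fst (f i)" for i
  define p where "p i = fst (snd (f i))" for i
  define V where "V i = snd (snd (f i))" for i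
  have f_eq: "f i = (N i, p i, V i)" for i
    by (simp add: N_def p_def V_def)
  have N1: "N i \<ge> 1" and p0: "p i 0 = x" and pN: "p i (N i) = y"
    and pV: "j < N i \<Longrightarrow> p i j \<in> V i j" and pV': "j < N i \<Longrightarrow> p i (Suc j) \<in> V i j"
    and VU: "j < N i \<Longrightarrow> V i j \<subseteq> U" for i j
    using f(1)[of i] unfolding P_def f_eq by auto
  have nest: "closure (V (Suc i) (piece (N (Suc i)) t)) \<subseteq> V i (piece (N i) t) - F i"
    and mesh: "\<forall>u\<in>V (Suc i) (piece (N (Suc i)) t). \<forall>v\<in>V (Suc i) (piece (N (Suc i)) t). dist u v < inverse (real (Suc i))"
    if t: "t \<ge> 0" for i t
  proof -
    obtain m where m: "m \<ge> 1" "N (Suc i) = N i * m"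
      and k: "\<And>k. k < N i * m \<Longrightarrow> closure (V (Suc i) k) \<subseteq> V i (k div m) - F i"
         "\<And>k. k < N i * m \<Longrightarrow> \<forall>u\<in>V (Suc i) k. \<forall>v\<in>V (Suc i) k. dist u v < inverse (real (Suc i))"
      using f(2)[of i] unfolding Q_def f_eq by auto
    have "piece (N (Suc i)) t < N i * m"
      using piece_less[OF N1 t, of "Suc i"] m by simp
    then show "closure (V (Suc i) (piece (N (Suc i)) t)) \<subseteq> V i (piece (N i) t) - F i"
      and "\<forall>u\<in>V (Suc i) (piece (N (Suc i)) t). \<forall>v\<in>V (Suc i) (piece (N (Suc i)) t). dist u v < inverse (real (Suc i))"
      using k[of "piece (N (Suc i)) t"] piece_div[OF N1 m(1) t, of i] m(2) by simp_all
  qed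
  define D where "D t i = V i (piece (N i) t)" for t i
  \<comment> \<open>The left joint of the link of \<open>t\<close>; the links are nested and shrink,
    so these points form a Cauchy sequence.\<close>
  define h where "h t i = p i (piece (N i) t)" for t i
  have D_Suc: "closure (D t (Suc i)) \<subseteq> D t i - F i" if "t \<ge> 0" for t i
    using nest[OF that] by (simp add: D_def)
  have D_mesh: "dist u v < inverse (real (Suc i))" if "t \<ge> 0" "u \<in> D t (Suc i)" "v \<in> D t (Suc i)" for t i u v
    using mesh[OF that(1)] that by (simp add: D_def)
  have D_anti: "D t j \<subseteq> D t i" if "t \<ge> 0" "i \<le> j" for t i j
    using that(2)
  proof (rule lift_Suc_antimono_le[rotated])
    show "D t (Suc n) \<subseteq> D t n" for n
      using D_Suc[OF that(1), of n] closure_subset[of "D t (Suc n)"] by blast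
  qed
  have hD: "h t i \<in> D t i" if "t \<ge> 0" for t i
    using pV[OF piece_less[OF N1 that]] by (simp add: h_def D_def)
  have ex: "\<exists>z. h t \<longlonglongrightarrow> z" if t: "t \<ge> 0" for t
  proof -
    have "Cauchy (h t)"
    proof (rule metric_CauchyI)
      fix e :: real assume "e > 0"
      then obtain i where i: "inverse (real (Suc i)) < e" using reals_Archimedean by blast
      have "dist (h t a) (h t b) < e" if "a \<ge> Suc i" "b \<ge> Suc i" for a b
        using D_mesh[OF t, of "h t a" i "h t b"] hD[OF t, of a] hD[OF t, of b]
          D_anti[OF t that(1)] D_anti[OF t that(2)] i by fastforce
      then show "\<exists>M. \<forall>a\<ge>M. \<forall>b\<ge>M. dist (h t a) (h t b) < e" by blast
    qed
    then show ?thesis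
      using Cauchy_convergent convergent_def by blast
  qed
  define g where "g t = (SOME z. h t \<longlonglongrightarrow> z)" for t
  have g_lim: "h t \<longlonglongrightarrow> g t" if "t \<ge> 0" for t
    unfolding g_def using ex[OF that] by (rule someI_ex)
  have gD: "g t \<in> D t i - F i" if t: "t \<ge> 0" for t i
  proof -
    have "g t \<in> closure (D t (Suc i))"
    proof (rule Lim_in_closed_set[OF closed_closure _ _ g_lim[OF t]])
      show "eventually (\<lambda>n. h t n \<in> closure (D t (Suc i))) sequentially"
        using eventually_ge_at_top[of "Suc i"]
      proof eventually_elim
        case (elim n)
        then have "h t n \<in> D t (Suc i)"
          using hD[OF t, of n] D_anti[OF t elim] by blast
        then show ?case
          using closure_subset by blast
      qed
    qed simp
    then show ?thesis using D_Suc[OF t] by blast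
  qed
  have cont: "continuous_on {0..1} g"
    unfolding continuous_on_iff
  proof (intro ballI allI impI)
    fix t e :: real assume t: "t \<in> {0..1}" and "e > 0"
    \<comment> \<open>Half of \<open>e\<close> for each of the two links that a short step in the
      parameter can involve.\<close>
    then obtain i where i: "inverse (real (Suc i)) < e / 2"
      using reals_Archimedean[of "e / 2"] by auto
    define n where "n = N (Suc i)"
    have close: "dist (g a) (g b) < e"
      if ab: "a \<in> {0..1}" "b \<in> {0..1}" "\<bar>a - b\<bar> < 1 / n" and le: "piece n a \<le> piece n b" for a b
    proof -
      have gab: "g a \<in> V (Suc i) (piece n a)" "g b \<in> V (Suc i) (piece n b)"
        using gD[of a "Suc i"] gD[of b "Suc i"] ab by (auto simp: D_def n_def)
      have "piece n b \<le> Suc (piece n a)"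
        using piece_le_Suc[of n b a] ab N1[of "Suc i"] by (simp add: n_def abs_minus_commute)
      then consider "piece n b = piece n a" | "piece n b = Suc (piece n a)"
        using le by linarith
      then show ?thesis
      proof cases
        case 1
        then have "dist (g a) (g b) < inverse (real (Suc i))"
          using D_mesh[of a "g a" i "g b"] gab ab by (simp add: D_def n_def)
        then show ?thesis using i \<open>e > 0\<close> by linarith
      next
        case 2
        let ?z = "p (Suc i) (Suc (piece n a))"
        have "?z \<in> V (Suc i) (piece n a)"
          using pV'[of "piece n a" "Suc i"] piece_less[of n a] N1[of "Suc i"] ab by (simp add: n_def)
        then have 1: "dist (g a) ?z < inverse (real (Suc i))"
          using D_mesh[of a "g a" i ?z] gab ab by (simp add: D_def n_def)
        have "?z \<in> V (Suc i) (piece n b)"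
          using pV[of "piece n b" "Suc i"] piece_less[of n b] N1[of "Suc i"] ab 2 by (simp add: n_def)
        then have "dist ?z (g b) < inverse (real (Suc i))"
          using D_mesh[of b ?z i "g b"] gab ab by (simp add: D_def n_def)
        then show ?thesis
          using 1 i dist_triangle[of "g a" "g b" ?z] by linarith
      qed
    qed
    have "dist (g s) (g t) < e" if "s \<in> {0..1}" "dist s t < 1 / n" for s
      using close[of s t] close[of t s] that t
      by (cases "piece n s \<le> piece n t") (auto simp: dist_real_def dist_commute abs_minus_commute)
    moreover have "1 / real n > 0"
      using N1[of "Suc i"] by (simp add: n_def)
    ultimately show "\<exists>d>0. \<forall>s\<in>{0..1}. dist s t < d \<longrightarrow> dist (g s) (g t) < e"
      by blast
  qed
  have eqI: "u = v" if "\<And>i. dist u v < inverse (real (Suc i))" for u v :: 'a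
  proof (rule ccontr)
    assume "u \<noteq> v"
    then obtain i where "inverse (real (Suc i)) < dist u v"
      using reals_Archimedean[of "dist u v"] by auto
    with that[of i] show False by simp
  qed
  have g0: "g 0 = x"
  proof (rule eqI)
    fix i
    have "piece (N (Suc i)) 0 = 0" by (simp add: piece_def)
    then have "x \<in> D 0 (Suc i)"
      using pV[of 0 "Suc i"] N1[of "Suc i"] p0[of "Suc i"] by (simp add: D_def)
    then show "dist (g 0) x < inverse (real (Suc i))"
      using D_mesh[of 0 "g 0" i x] gD[of 0 "Suc i"] by simp
  qed
  have g1: "g 1 = y"
  proof (rule eqI)
    fix i
    have "piece (N (Suc i)) 1 = N (Suc i) - 1" by (simp add: piece_def)
    then have "y \<in> D 1 (Suc i)"
      using pV'[of "N (Suc i) - 1" "Suc i"] N1[of "Suc i"] pN[of "Suc i"] by (simp add: D_def)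
    then show "dist (g 1) y < inverse (real (Suc i))"
      using D_mesh[of 1 "g 1" i y] gD[of 1 "Suc i"] by simp
  qed
  have "g t \<in> U - M" if t: "t \<in> {0..1}" for t
  proof -
    have "D t 0 \<subseteq> U"
      using VU[OF piece_less[OF N1]] t by (simp add: D_def)
    then show ?thesis
      using gD[of t] t unfolding M_def by auto
  qed
  then have "path_image g \<subseteq> U - (\<Union>i. F i)"
    by (auto simp: path_image_def M_def)
  then show ?thesis
    using cont g0 g1 by (intro exI[of _ g]) (simp add: path_def pathstart_def pathfinish_def)
qed

section \<open>Complements of sets of small dimension\<close>

text \<open>The Kuratowski embedding \<open>a \<mapsto> d(a, -) - d(p 0, -)\<close> into a Banach space reduces the claim to
normed spaces.\<close>

lemma path_contains_arc_metric:
  fixes p :: "real \<Rightarrow> 'a::metric_space"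
  assumes "path p" "pathstart p \<noteq> pathfinish p"
  obtains q where "arc q" "path_image q \<subseteq> path_image p" "pathstart q = pathstart p" "pathfinish q = pathfinish p"
proof -
  let ?b = "p 0"
  define K :: "'a \<Rightarrow> ('a \<Rightarrow>\<^sub>C real)" where "K = (\<lambda>a. Bcontfun (\<lambda>z. dist a z - dist ?b z))"
  have app: "apply_bcontfun (K a) z = dist a z - dist ?b z" for a z
  proof -
    have "(\<lambda>z. dist a z - dist ?b z) \<in> bcontfun"
    proof (rule bcontfun_normI)
      show "continuous_on UNIV (\<lambda>z. dist a z - dist ?b z)"
        by (intro continuous_intros)
      show "norm (dist a z - dist ?b z) \<le> dist a ?b" for z
        using abs_dist_diff_le[of a z ?b] by (simp add: dist_commute)
    qed
    then show ?thesis
      by (simp add: K_def Bcontfun_inverse)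
  qed
  have iso: "dist (K a) (K c) = dist a c" for a c
  proof (rule antisym)
    show "dist (K a) (K c) \<le> dist a c"
    proof (rule dist_bound)
      show "dist (apply_bcontfun (K a) z) (apply_bcontfun (K c) z) \<le> dist a c" for z
        using abs_dist_diff_le[of a z c] by (simp add: app dist_real_def dist_commute)
    qed
    show "dist a c \<le> dist (K a) (K c)"
      using dist_bounded[of "K a" c "K c"] by (simp add: app dist_real_def)
  qed
  have inj: "inj K"
    by (rule injI) (metis dist_eq_0_iff iso)
  have contK: "continuous_on S K" for S
    by (rule continuous_onI) (use iso in auto)
  have "path (K \<circ> p)"
    using assms(1) contK by (simp add: path_continuous_image)
  moreover have "pathstart (K \<circ> p) \<noteq> pathfinish (K \<circ> p)"
    using assms(2) inj by (simp add: pathstart_compose pathfinish_compose inj_eq)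
  ultimately obtain r where r: "arc r" "path_image r \<subseteq> path_image (K \<circ> p)"
    "pathstart r = pathstart (K \<circ> p)" "pathfinish r = pathfinish (K \<circ> p)"
    using path_contains_arc[of "K \<circ> p" "pathstart (K \<circ> p)" "pathfinish (K \<circ> p)"] by blast
  define L where "L = inv_into UNIV K"
  have LK: "L (K a) = a" for a
    using inj by (simp add: L_def)
  have r_im: "path_image r \<subseteq> K ` path_image p"
    using r(2) by (simp add: path_image_compose)
  have contL: "continuous_on (path_image r) L"
  proof (rule continuous_onI)
    fix u e assume u: "u \<in> path_image r" and "e > (0::real)"
    have "dist (L v) (L u) = dist v u" if v: "v \<in> path_image r" for v
    proof -
      obtain a c where "u = K a" "v = K c"
        using u v r_im by blast
      then show ?thesis by (simp add: LK iso)
    qed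
    then show "\<exists>d>0. \<forall>v\<in>path_image r. dist v u < d \<longrightarrow> dist (L v) (L u) \<le> e"
      using \<open>e > 0\<close> by (intro exI[of _ e]) auto
  qed
  have "inj_on L (path_image r)"
    using r_im LK by (intro inj_onI) (metis imageE subsetD)
  show thesis
  proof (rule that[of "L \<circ> r"])
    show "arc (L \<circ> r)"
      using r(1) contL \<open>inj_on L (path_image r)\<close> unfolding arc_def path_def
      by (metis comp_inj_on continuous_on_compose path_image_def)
    show "path_image (L \<circ> r) \<subseteq> path_image p"
      using r_im LK by (auto simp: path_image_compose)
    show "pathstart (L \<circ> r) = pathstart p" "pathfinish (L \<circ> r) = pathfinish p"
      using r(3,4) by (simp_all add: pathstart_compose pathfinish_compose LK)
  qed
qed

text \<open>A second point in the space makes the complement of \<open>x\<close> nonempty, so the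
  property speaks of the relative group, which excision transfers to \<open>U\<close>.\<close>

lemma has_local_H_trivial_open_subset:
  fixes U :: "'a::metric_space set"
  assumes H: "has_local_H (int m) (euclidean :: 'a topology)" and "(UNIV :: 'a set) \<noteq> {x}"
    and U: "open U" "x \<in> U" and "k \<le> m"
  shows "trivial_group (relative_homology_group (int k) (top_of_set U) (U - {x}))"
proof (rule trivial_relative_homology_group_open_subset)
  have "trivial_group (if UNIV - {x} = {} then reduced_homology_group (int k) (euclidean :: 'a topology)
          else relative_homology_group (int k) euclidean (UNIV - {x}))"
    using H[unfolded has_local_H_def, rule_format, of x "int k"] \<open>k \<le> m\<close>
    by (simp only: topspace_euclidean) simp
  moreover have "UNIV - {x} \<noteq> {}"
    using assms(2) by blast
  ultimately show "trivial_group (relative_homology_group (int k) euclidean (topspace euclidean - {x}))"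
    by simp
qed (use U in auto)

text \<open>With a tower of index \<open>m\<close> and the local property up to degree
  \<open>m\<close>, the condition \<open>k + m \<le> Suc m\<close> allows precisely the degrees 0
  and 1.\<close>

lemma has_local_H_complement_connected:
  fixes U A :: "'a::complete_space set"
  assumes lc: "locally connected (UNIV :: 'a set)" and H: "has_local_H (int m) (euclidean :: 'a topology)"
    and pt: "\<And>x. (UNIV :: 'a set) \<noteq> {x}"
    and A: "cover_tower m A"
    and U: "open U" "connected U" "U \<noteq> {}"
  shows "connected (U - A) \<and> U - A \<noteq> {}"
proof -
  let ?X = "top_of_set U"
  \<comment> \<open>With empty sets to avoid, the path construction shows that a connected open set
    is path connected.\<close>
  have pc: "path_connected U"
    unfolding path_connected_def
    using path_avoiding_closed_sets[OF lc, of "\<lambda>_. {}" U] U by auto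
  have triv: "trivial_group (relative_homology_group (int k) ?X (U - A))" if "k \<le> 1" for k
    using trivial_relative_homology_cover_tower[OF refl U(1) has_local_H_trivial_open_subset[OF H pt U(1)] A] that
    by simp
  have "path_connectedin ?X (U - A)" "U - A \<noteq> {}"
    using path_connected_subspace_if_trivial_relative_homology[of ?X "U - A"] triv[of 0] triv[of 1] U pc
    by auto
  then show ?thesis
    using path_connected_imp_connected by (auto simp: path_connectedin_subtopology)
qed

theorem theorem4p3:
  fixes M :: "'a::complete_space set" and n :: int
  assumes "n \<ge> 1"
    and "connected (UNIV :: 'a set)"
    and "locally connected (UNIV :: 'a set)"
    and "has_local_H (n - 1) (euclidean :: 'a topology)"
    and "fsigma_in euclidean M"
    and "covering_dim_le (subtopology euclidean M) (n - 2)"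
  shows "\<forall>U. open U \<and> connected U \<and> U - M \<noteq> {} \<longrightarrow> arcwise_connected (U - M)"
proof (intro allI impI)
  fix U assume U: "open U \<and> connected U \<and> U - M \<noteq> {}"
  define m where "m = nat (n - 1)"
  have m: "n - 1 = int m"
    using assms(1) by (simp add: m_def)
  show "arcwise_connected (U - M)"
    unfolding arcwise_connected_def
  proof (intro ballI impI)
    fix x y assume xy: "x \<in> U - M" "y \<in> U - M" "x \<noteq> y"
    \<comment> \<open>Two distinct points exclude the one-point space, the only case in which the
      property refers to the reduced group.\<close>
    have pt: "(UNIV :: 'a set) \<noteq> {z}" for z
      using xy(3) by (metis UNIV_I singletonD)
    obtain F where F: "\<And>i. closed (F i)" "(\<Union>i::nat. F i) = M"
      using assms(5) unfolding fsigma_in_ascending closed_closedin[symmetric] by blast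
    \<comment> \<open>Dimension at most \<open>n - 2\<close> is order at most \<open>n - 1\<close>,
      which is \<open>m\<close>. The dimension bound passes to \<open>F i\<close> as a closed subset
      of \<open>M\<close>, and the tower uses that \<open>F i\<close> is closed in the whole
      space.\<close>
    have tower: "cover_tower m (F i)" for i
    proof (rule covering_dim_le_imp_cover_tower[OF F(1)])
      have FM: "F i \<subseteq> M"
        using F(2) by blast
      then have "closedin (top_of_set M) (F i)"
        using F(1) closed_subset by blast
      then have "covering_dim_le (subtopology (top_of_set M) (F i)) (n - 2)"
        using covering_dim_le_closed_subtopology assms(6) by blast
      then show "covering_dim_le (top_of_set (F i)) (int m - 1)"
        using m FM by (simp add: subtopology_subtopology Int_absorb1 flip: m)
    qed
    have "\<exists>g. path g \<and> path_image g \<subseteq> U - (\<Union>i. F i) \<and> pathstart g = x \<and> pathfinish g = y"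
    proof (rule path_avoiding_closed_sets[OF assms(3) F(1)])
      show "connected (V - F i) \<and> V - F i \<noteq> {}" if "open V" "connected V" "V \<noteq> {}" for V i
        using has_local_H_complement_connected[OF assms(3) _ pt tower that] assms(4) m by simp
    qed (use U xy F in auto)
    then obtain p where "path p" "path_image p \<subseteq> U - M" "pathstart p = x" "pathfinish p = y"
      using F(2) by auto
    then show "\<exists>g. arc g \<and> path_image g \<subseteq> U - M \<and> pathstart g = x \<and> pathfinish g = y"
      using path_contains_arc_metric[of p] xy(3) by (metis order_trans)
  qed
qed

end
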